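(* The \textsc{Best Response} problem (defined in the context) can be solved in $O((1+m)^{n+4})$ time, where $m$ is the number of items and $n$ the number of agents. In particular, for every constant number $n$ of agents, \textsc{Best Response} is solvable in polynomial time.
   Context: Sequential allocation: a set $O=\{g_1,\dots,g_m\}$ of $m$ indivisible items is allocated to agents $N=\{1,\dots,n\}$ according to a policy $\pi$, a sequence of agents of length $m$. Each agent $i$ has a strict complete preference ranking $\succ_i$ over $O$. Agent 1 is the manipulator and has an additive utility function $u:O\to\mathbb{R}_{>0}$ consistent with $\succ_1$ (i.e. $u(g_x)>u(g_y)$ iff $g_x\succ_1 g_y$); agents $2,\dots,n$ are non-manipulators. Items are allocated in turns following $\pi$: at a turn of a non-manipulator $i$, it takes its most preferred (under $\succ_i$) item not yet allocated. The manipulator reports a picking strategy, i.e. a permutation of $O$, and at each of its turns it takes the first item in this permutation that has not yet been allocated. The manipulator knows all other agents' rankings. \textsc{Best Response}: given $(O,N,\pi,\{\succ_i\}_{i=1}^n)$ and $u$, find a picking strategy maximizing the total utility $\sum u(g)$ of the bundle the manipulator receives. *)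

theory Defs
  imports Complex_Main "HOL-Combinatorics.Multiset_Permutations"
begin

section \<open>Sequential allocation\<close>

text \<open>
  The items \<open>g\<^sub>1, \<dots>, g\<^sub>m\<close> are represented by their indices \<open>1, \<dots>, m\<close>. A strict complete ranking
  is the list of all items in decreasing order of preference.
\<close>

record seq_alloc =
  num_items :: nat
  num_agents :: nat
  policy :: "nat list"
  ranking :: "nat \<Rightarrow> nat list"
  util :: "nat \<Rightarrow> real"

definition items :: "seq_alloc \<Rightarrow> nat set" where
  "items I = {1..num_items I}"

definition agents :: "seq_alloc \<Rightarrow> nat set" where
  "agents I = {1..num_agents I}"

definition prefers :: "nat list \<Rightarrow> nat \<Rightarrow> nat \<Rightarrow> bool" where
  "prefers xs x y \<longleftrightarrow> (\<exists>i j. i < j \<and> j < length xs \<and> xs ! i = x \<and> xs ! j = y)"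

definition valid :: "seq_alloc \<Rightarrow> bool" where
  "valid I \<longleftrightarrow>
     num_agents I \<ge> 1 \<and>
     length (policy I) = num_items I \<and> set (policy I) \<subseteq> agents I \<and>
     (\<forall>i \<in> agents I. ranking I i \<in> permutations_of_set (items I)) \<and>
     (\<forall>g \<in> items I. util I g > 0) \<and>
     (\<forall>x \<in> items I. \<forall>y \<in> items I. util I x > util I y \<longleftrightarrow> prefers (ranking I 1) x y)"

definition first_available :: "nat list \<Rightarrow> nat set \<Rightarrow> nat" where
  "first_available xs R = hd (filter (\<lambda>g. g \<in> R) xs)"

text \<open>
  \<open>P i\<close> is the list according to which agent \<open>i\<close> picks, the second argument is the rest of the
  policy and \<open>R\<close> is the set of items not yet allocated. The result lists who takes what.
\<close>

fun allocation :: "(nat \<Rightarrow> nat list) \<Rightarrow> nat list \<Rightarrow> nat set \<Rightarrow> (nat \<times> nat) list" where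
  "allocation P [] R = []"
| "allocation P (i # p) R =
     (let g = first_available (P i) R in (i, g) # allocation P p (R - {g}))"

definition manipulator_bundle :: "seq_alloc \<Rightarrow> nat list \<Rightarrow> nat set" where
  "manipulator_bundle I \<sigma> =
     {g. (1, g) \<in> set (allocation ((ranking I)(1 := \<sigma>)) (policy I) (items I))}"

definition manipulator_utility :: "seq_alloc \<Rightarrow> nat list \<Rightarrow> real" where
  "manipulator_utility I \<sigma> = (\<Sum>g \<in> manipulator_bundle I \<sigma>. util I g)"

definition best_response :: "seq_alloc \<Rightarrow> nat list \<Rightarrow> bool" where
  "best_response I \<sigma> \<longleftrightarrow>
     \<sigma> \<in> permutations_of_set (items I) \<and>
     (\<forall>\<sigma>' \<in> permutations_of_set (items I). manipulator_utility I \<sigma>' \<le> manipulator_utility I \<sigma>)"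

section \<open>Machine model\<close>

text \<open>
  A random access machine with structured control and unit-cost operations. Its memory consists of
  unbounded arrays of natural numbers and unbounded arrays of reals. The name of an array is part
  of the program text and cannot be computed, so every program uses finitely many arrays; indices
  can be computed (indirect addressing). Natural numbers are added, subtracted (truncated at 0)
  and compared; there is no multiplication, which at unit cost would make the machine unreasonably
  powerful. Reals, which serve to hold utilities, are copied, added, subtracted and compared, and
  cannot be converted to natural numbers.
\<close>

datatype nexp =
    Const nat
  | NArr nat nexp
  | NAdd nexp nexp
  | NSub nexp nexp

datatype rexp =
    RZero
  | RArr nat nexp
  | RAdd rexp rexp
  | RSub rexp rexp

datatype bexp =
    NLess nexp nexp
  | RLess rexp rexp
  | Neg bexp
  | Conj bexp bexp

datatype com =
    Skip
  | NAssign nat nexp nexp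
  | RAssign nat nexp rexp
  | Seq com com
  | Cond bexp com com
  | While bexp com

record state =
  nmem :: "nat \<Rightarrow> nat \<Rightarrow> nat"
  rmem :: "nat \<Rightarrow> nat \<Rightarrow> real"

primrec nval :: "nexp \<Rightarrow> state \<Rightarrow> nat" where
  "nval (Const k) s = k"
| "nval (NArr a e) s = nmem s a (nval e s)"
| "nval (NAdd e f) s = nval e s + nval f s"
| "nval (NSub e f) s = nval e s - nval f s"

primrec rval :: "rexp \<Rightarrow> state \<Rightarrow> real" where
  "rval RZero s = 0"
| "rval (RArr a e) s = rmem s a (nval e s)"
| "rval (RAdd e f) s = rval e s + rval f s"
| "rval (RSub e f) s = rval e s - rval f s"

primrec bval :: "bexp \<Rightarrow> state \<Rightarrow> bool" where
  "bval (NLess e f) s \<longleftrightarrow> nval e s < nval f s"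
| "bval (RLess e f) s \<longleftrightarrow> rval e s < rval f s"
| "bval (Neg b) s \<longleftrightarrow> \<not> bval b s"
| "bval (Conj b c) s \<longleftrightarrow> bval b s \<and> bval c s"

text \<open>The cost of evaluating an expression is its number of constructors.\<close>

primrec ncost :: "nexp \<Rightarrow> nat" where
  "ncost (Const k) = 1"
| "ncost (NArr a e) = 1 + ncost e"
| "ncost (NAdd e f) = 1 + ncost e + ncost f"
| "ncost (NSub e f) = 1 + ncost e + ncost f"

primrec rcost :: "rexp \<Rightarrow> nat" where
  "rcost RZero = 1"
| "rcost (RArr a e) = 1 + ncost e"
| "rcost (RAdd e f) = 1 + rcost e + rcost f"
| "rcost (RSub e f) = 1 + rcost e + rcost f"

primrec bcost :: "bexp \<Rightarrow> nat" where
  "bcost (NLess e f) = 1 + ncost e + ncost f"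
| "bcost (RLess e f) = 1 + rcost e + rcost f"
| "bcost (Neg b) = 1 + bcost b"
| "bcost (Conj b c) = 1 + bcost b + bcost c"

definition nwrite :: "nat \<Rightarrow> nat \<Rightarrow> nat \<Rightarrow> state \<Rightarrow> state" where
  "nwrite a i v s = s\<lparr>nmem := (nmem s)(a := (nmem s a)(i := v))\<rparr>"

definition rwrite :: "nat \<Rightarrow> nat \<Rightarrow> real \<Rightarrow> state \<Rightarrow> state" where
  "rwrite a i v s = s\<lparr>rmem := (rmem s)(a := (rmem s a)(i := v))\<rparr>"

text \<open>\<open>exec c s k t\<close>: started in \<open>s\<close>, program \<open>c\<close> terminates in \<open>t\<close> after exactly \<open>k\<close> time steps.\<close>

inductive exec :: "com \<Rightarrow> state \<Rightarrow> nat \<Rightarrow> state \<Rightarrow> bool" where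
  Skip: "exec Skip s 1 s"
| NAssign: "exec (NAssign a e f) s (1 + ncost e + ncost f) (nwrite a (nval e s) (nval f s) s)"
| RAssign: "exec (RAssign a e f) s (1 + ncost e + rcost f) (rwrite a (nval e s) (rval f s) s)"
| Seq: "exec c s k s' \<Longrightarrow> exec d s' l s'' \<Longrightarrow> exec (Seq c d) s (1 + k + l) s''"
| CondTrue: "bval b s \<Longrightarrow> exec c s k s' \<Longrightarrow> exec (Cond b c d) s (1 + bcost b + k) s'"
| CondFalse: "\<not> bval b s \<Longrightarrow> exec d s k s' \<Longrightarrow> exec (Cond b c d) s (1 + bcost b + k) s'"
| WhileFalse: "\<not> bval b s \<Longrightarrow> exec (While b c) s (1 + bcost b) s"
| WhileTrue: "bval b s \<Longrightarrow> exec c s k s' \<Longrightarrow> exec (While b c) s' l s'' \<Longrightarrow>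
    exec (While b c) s (1 + bcost b + k + l) s''"

inductive_cases SkipE: "exec Skip s k t"
  and NAssignE: "exec (NAssign a e f) s k t"
  and RAssignE: "exec (RAssign a e f) s k t"
  and SeqE: "exec (Seq c d) s k t"
  and CondE: "exec (Cond b c d) s k t"
  and WhileE: "exec (While b c) s k t"

lemma exec_deterministic:
  assumes "exec c s k t" and "exec c s k' t'"
  shows "k' = k \<and> t' = t"
  using assms
proof (induction arbitrary: k' t' rule: exec.induct)
  case (Seq c s k s' d l s'')
  from Seq.prems show ?case
    by (rule SeqE) (auto dest!: Seq.IH(1) Seq.IH(2))
next
  case (CondTrue b s c k s' d)
  from CondTrue.prems show ?case
    by (rule CondE) (use CondTrue.hyps in \<open>auto dest!: CondTrue.IH\<close>)
next
  case (CondFalse b s d k s' c)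
  from CondFalse.prems show ?case
    by (rule CondE) (use CondFalse.hyps in \<open>auto dest!: CondFalse.IH\<close>)
next
  case (WhileFalse b s c)
  from WhileFalse.prems show ?case
    by (rule WhileE) (use WhileFalse.hyps in auto)
next
  case (WhileTrue b s c k s' l s'')
  from WhileTrue.prems WhileTrue.hyps(1) obtain k1 s1 l1
    where eq: "k' = 1 + bcost b + k1 + l1"
      and c: "exec c s k1 s1" and w: "exec (While b c) s1 l1 t'"
    by (auto elim: WhileE)
  from WhileTrue.IH(1)[OF c] have "k1 = k" "s1 = s'" by simp_all
  with WhileTrue.IH(2)[of l1 t'] w eq show ?case by simp
qed (auto elim: SkipE NAssignE RAssignE)

section \<open>Solving the best response problem on the machine\<close>

text \<open>
  Input: array 0 holds \<open>m\<close> and \<open>n\<close>, array 1 the policy, array 2 the rankings of agents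
  \<open>1, \<dots>, n\<close> one after the other, and real array 0 the utility of item \<open>g\<close> at index \<open>g\<close>. All other
  cells are 0. Output: the picking strategy in cells \<open>0, \<dots>, m - 1\<close> of array 3.
\<close>

definition initial_state :: "seq_alloc \<Rightarrow> state" where
  "initial_state I =
     (let m = num_items I; n = num_agents I in
      \<lparr>nmem = (\<lambda>a j.
         if a = 0 \<and> j = 0 then m
         else if a = 0 \<and> j = 1 then n
         else if a = 1 \<and> j < m then policy I ! j
         else if a = 2 \<and> j < n * m then ranking I (j div m + 1) ! (j mod m)
         else 0),
       rmem = (\<lambda>a j. if a = 0 \<and> j \<in> items I then util I j else 0)\<rparr>)"

definition output_strategy :: "seq_alloc \<Rightarrow> state \<Rightarrow> nat list" where
  "output_strategy I s = map (nmem s 3) [0..<num_items I]"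

text \<open>The number of cells occupied by the input.\<close>

definition input_size :: "seq_alloc \<Rightarrow> nat" where
  "input_size I = 2 + num_items I + num_agents I * num_items I + num_items I"

definition solves_best_response_in_time ::
  "com \<Rightarrow> seq_alloc set \<Rightarrow> (seq_alloc \<Rightarrow> nat) \<Rightarrow> bool" where
  "solves_best_response_in_time c \<I> T \<longleftrightarrow>
     (\<forall>I \<in> \<I>. \<exists>k s. exec c (initial_state I) k s \<and> k \<le> T I \<and> best_response I (output_strategy I s))"

end

theory Submission
  imports Defs
begin

text \<open>
  Suppose that at some point of the run the pointer of every non-manipulator \<open>i\<close> has passed the first
  \<open>p i\<close> items of its ranking. Items in one of these prefixes are touched; each of them is gone. The
  next non-manipulator to move looks at its next item \<open>x\<close>: it skips \<open>x\<close> if \<open>x\<close> is touched, and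
  otherwise it either takes \<open>x\<close> or finds that the manipulator has taken \<open>x\<close> before. By time \<open>t\<close> exactly
  \<open>t\<close> items have been allocated, so the second outcome is possible precisely if fewer than \<open>t\<close> items
  are touched. Hence the pair \<open>(t, p)\<close> determines all continuations, and minimising the total
  utility taken by the non-manipulators is a shortest path problem on at most
  \<open>(m + 1) ^ n\<close> states. Picking the items left to the manipulator in the order in which they are
  touched, followed by the items that are never touched, realises an optimal path.
\<close>

text \<open>All items are allocated, so maximizing the manipulator's bundle is minimizing what the
  others take. Leaving \<open>x\<close> to the manipulator is realizable for this reason: if
  \<open>t\<close> items are gone, \<open>q\<close> of them to the manipulator, and the touched
  items are those taken by the others and \<open>k\<close> items left to the manipulator, then fewer
  than \<open>t\<close> touched items means \<open>k < q\<close>, so a manipulator who picks in the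
  order of touching already holds \<open>x\<close>. Two obstacles shape the program. The bound must
  hold with one constant for all \<open>n\<close>, even if \<open>n\<close> is far larger than
  \<open>m\<close>. Therefore only the agents of the policy, at most \<open>m\<close>, become digits
  of a state, and one table entry costs \<open>O(m ^ 2)\<close> instead of \<open>O(n * m)\<close>.
  One clock and at most \<open>n - 1\<close> pointers give at most \<open>(m + 1) ^ n\<close>
  states, so the table stays within exponent \<open>n + 2\<close>. And without multiplication or
  division, states are numbers in base \<open>m + 1\<close> that moves change by addition and that
  are read by repeated subtraction.\<close>

definition others :: "(nat \<times> nat) list \<Rightarrow> nat list" where
  "others xs = map snd (filter (\<lambda>(i, g). i \<noteq> 1) xs)"

lemma others_simps [simp]:
  "others [] = []"
  "others ((i, g) # xs) = (if i = 1 then others xs else g # others xs)"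
  by (auto simp: others_def)

lemma first_agent_items:
  "distinct (map snd xs) \<Longrightarrow> {g. (1, g) \<in> set xs} = snd ` set xs - set (others xs)"
proof (induction xs)
  case (Cons y xs)
  then have "set (others xs) \<subseteq> snd ` set xs" "snd y \<notin> snd ` set xs"
    by (auto simp: others_def)
  with Cons show ?case by (cases y) force
qed auto

lemma first_available_mem:
  assumes "R \<noteq> {}" and "R \<subseteq> set xs"
  shows "first_available xs R \<in> R"
proof -
  have "filter (\<lambda>g. g \<in> R) xs \<noteq> []"
    using assms by (auto simp: filter_empty_conv)
  from hd_in_set[OF this] show ?thesis
    by (auto simp: first_available_def)
qed

lemma first_available_nth:
  assumes "k < length xs" and "xs ! k \<in> R" and "set (take k xs) \<inter> R = {}"
  shows "first_available xs R = xs ! k"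
proof -
  have "filter (\<lambda>g. g \<in> R) (take k xs) = []"
    using assms(3) by (auto simp: filter_empty_conv)
  then have "filter (\<lambda>g. g \<in> R) xs = filter (\<lambda>g. g \<in> R) (drop k xs)"
    by (metis append_take_drop_id filter_append self_append_conv2)
  also have "\<dots> = xs ! k # filter (\<lambda>g. g \<in> R) (drop (Suc k) xs)"
    using assms(1,2) by (simp flip: Cons_nth_drop_Suc)
  finally show ?thesis
    by (simp add: first_available_def)
qed

text \<open>Equal lengths keep \<open>R\<close> nonempty at every turn, so
  \<open>first_available\<close> never takes the \<open>hd\<close> of an empty list.\<close>

lemma allocation_items:
  assumes "\<And>i. i \<in> set q \<Longrightarrow> R \<subseteq> set (P i)" and "finite R" and "length q = card R"
  shows "set (map snd (allocation P q R)) = R \<and> distinct (map snd (allocation P q R))"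
  using assms
proof (induction q arbitrary: R)
  case Nil
  then show ?case by simp
next
  case (Cons i q)
  define g where "g = first_available (P i) R"
  have "R \<noteq> {}" using Cons.prems by auto
  then have g: "g \<in> R" unfolding g_def using Cons.prems(1)[of i]
    by (intro first_available_mem) auto
  have "set (map snd (allocation P q (R - {g}))) = R - {g}
      \<and> distinct (map snd (allocation P q (R - {g})))"
  proof (rule Cons.IH)
    show "R - {g} \<subseteq> set (P i)" if "i \<in> set q" for i
      using that Cons.prems(1)[of i] by auto
  qed (use Cons.prems g in \<open>auto simp: card_Diff_singleton\<close>)
  then show ?case
    using g unfolding allocation.simps Let_def g_def[symmetric] by auto
qed

section \<open>Optimal play\<close>

locale sequential_allocation =
  fixes I :: seq_alloc
  assumes valid_instance: "valid I"
begin

abbreviation "m \<equiv> num_items I"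
abbreviation "pol \<equiv> policy I"
abbreviation "rank \<equiv> ranking I"
abbreviation "u \<equiv> util I"

lemma length_pol: "length pol = m"
  and one_le_agents: "1 \<le> num_agents I"
  and pol_agent: "i \<in> set pol \<Longrightarrow> i \<in> {1..num_agents I}"
  and distinct_rank: "i \<in> {1..num_agents I} \<Longrightarrow> distinct (rank i)"
  and set_rank: "i \<in> {1..num_agents I} \<Longrightarrow> set (rank i) = {1..m}"
  using valid_instance
  by (auto simp: valid_def agents_def items_def permutations_of_set_def)

lemma length_rank: "i \<in> {1..num_agents I} \<Longrightarrow> length (rank i) = m"
  using distinct_rank[of i] set_rank[of i] distinct_card[of "rank i"] by simp

lemma pol_nth_agent: "t < m \<Longrightarrow> pol ! t \<in> {1..num_agents I}"
  using pol_agent[of "pol ! t"] length_pol by simp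

section \<open>The shortest path recursion\<close>

definition cost :: "nat list \<Rightarrow> real" where
  "cost xs = sum_list (map u xs)"

lemma cost_simps [simp]: "cost [] = 0" "cost (x # xs) = u x + cost xs"
  by (auto simp: cost_def)

definition touched :: "(nat \<Rightarrow> nat) \<Rightarrow> nat set" where
  "touched p = (\<Union>i \<in> set pol - {1}. set (take (p i) (rank i)))"

text \<open>The components are the items left to the manipulator and the items taken by the others,
  in the order of touching; only the second is charged. The value at \<open>m \<le> p i\<close> is a
  default for states with more touched than allocated items: the table ranges over all codes, so
  \<open>opt\<close> has to be total.\<close>

function opt :: "nat \<Rightarrow> (nat \<Rightarrow> nat) \<Rightarrow> nat list \<times> nat list" where
  "opt t p =
    (if m \<le> t then ([], [])
     else let i = pol ! t in
       if i = 1 then opt (Suc t) p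
       else if m \<le> p i then ([], [])
       else let x = rank i ! p i; p' = p(i := Suc (p i)) in
         if x \<in> touched p then opt t p'
         else if card (touched p) < t \<and>
             cost (snd (opt t p')) < u x + cost (snd (opt (Suc t) p'))
           then apfst ((#) x) (opt t p')
           else apsnd ((#) x) (opt (Suc t) p'))"
  by pat_completeness auto
termination
  by (relation "measures [\<lambda>(t, p). m - t, \<lambda>(t, p). m - p (pol ! t)]") auto

declare opt.simps [simp del]

definition the_item :: "nat \<Rightarrow> (nat \<Rightarrow> nat) \<Rightarrow> nat" where
  "the_item t p = rank (pol ! t) ! p (pol ! t)"

definition bump :: "nat \<Rightarrow> (nat \<Rightarrow> nat) \<Rightarrow> nat \<Rightarrow> nat" where
  "bump t p = p(pol ! t := Suc (p (pol ! t)))"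

definition leaves :: "nat \<Rightarrow> (nat \<Rightarrow> nat) \<Rightarrow> bool" where
  "leaves t p \<longleftrightarrow> card (touched p) < t \<and>
     cost (snd (opt t (bump t p))) < u (the_item t p) + cost (snd (opt (Suc t) (bump t p)))"

lemma opt_unfold:
  "opt t p =
    (if m \<le> t then ([], [])
     else if pol ! t = 1 then opt (Suc t) p
     else if m \<le> p (pol ! t) then ([], [])
     else if the_item t p \<in> touched p then opt t (bump t p)
     else if leaves t p then apfst ((#) (the_item t p)) (opt t (bump t p))
     else apsnd ((#) (the_item t p)) (opt (Suc t) (bump t p)))"
  by (subst opt.simps) (simp add: Let_def the_item_def bump_def leaves_def)

text \<open>Merges the two outcomes for an untouched item into one case with both induction
  hypotheses, because optimality compares the outcomes whichever of them \<open>leaves\<close>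
  selects.\<close>

lemma opt_induct [case_names finished manipulator stuck skip pick]:
  assumes "\<And>t p. m \<le> t \<Longrightarrow> P t p"
    and "\<And>t p. t < m \<Longrightarrow> pol ! t = 1 \<Longrightarrow> P (Suc t) p \<Longrightarrow> P t p"
    and "\<And>t p. t < m \<Longrightarrow> pol ! t \<noteq> 1 \<Longrightarrow> m \<le> p (pol ! t) \<Longrightarrow> P t p"
    and "\<And>t p. t < m \<Longrightarrow> pol ! t \<noteq> 1 \<Longrightarrow> p (pol ! t) < m \<Longrightarrow> the_item t p \<in> touched p \<Longrightarrow>
      P t (bump t p) \<Longrightarrow> P t p"
    and "\<And>t p. t < m \<Longrightarrow> pol ! t \<noteq> 1 \<Longrightarrow> p (pol ! t) < m \<Longrightarrow> the_item t p \<notin> touched p \<Longrightarrow>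
      P t (bump t p) \<Longrightarrow> P (Suc t) (bump t p) \<Longrightarrow> P t p"
  shows "P t p"
proof (induction t p rule: opt.induct)
  case (1 t p)
  show ?case
  proof (cases "m \<le> t")
    case True
    then show ?thesis by (rule assms(1))
  next
    case t: False
    show ?thesis
    proof (cases "pol ! t = 1")
      case True
      show ?thesis
        by (rule assms(2)) (use t True "1.IH"(1)[OF t refl True] in simp_all)
    next
      case i: False
      show ?thesis
      proof (cases "m \<le> p (pol ! t)")
        case True
        show ?thesis by (rule assms(3)) (use t i True in simp_all)
      next
        case p: False
        show ?thesis
        proof (cases "the_item t p \<in> touched p")
          case True
          have "P t (bump t p)"
            using "1.IH"(2)[OF t refl i p refl refl] True
            by (simp add: the_item_def bump_def fun_upd_def)
          then show ?thesis
            by (rule assms(4)[OF _ i, rotated -1]) (use t p True in simp_all)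
        next
          case False
          have "P t (bump t p)" "P (Suc t) (bump t p)"
            using "1.IH"(3,4)[OF t refl i p refl refl] False
            by (simp_all add: the_item_def bump_def fun_upd_def)
          then show ?thesis
            by (rule assms(5)[OF _ i, rotated -2]) (use t p False in simp_all)
        qed
      qed
    qed
  qed
qed

lemma touched_bump:
  assumes "t < m" "pol ! t \<noteq> 1" "p (pol ! t) < m"
  shows "touched (bump t p) = insert (the_item t p) (touched p)"
proof -
  let ?i = "pol ! t"
  have i: "?i \<in> set pol - {1}" using assms by (simp add: length_pol)
  have len: "p ?i < length (rank ?i)"
    using assms pol_nth_agent length_rank by simp
  have "touched q = set (take (q ?i) (rank ?i)) \<union>
      (\<Union>i \<in> set pol - {1, ?i}. set (take (q i) (rank i)))" for q
    using i by (auto simp: touched_def)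
  from this[of p] this[of "bump t p"] show ?thesis
    using len by (auto simp: bump_def the_item_def take_Suc_conv_app_nth)
qed

lemma touched_subset: "touched p \<subseteq> {1..m}"
  using pol_agent set_rank by (auto simp: touched_def dest!: in_set_takeD)

lemma finite_touched [simp]: "finite (touched p)"
  using touched_subset finite_subset by blast

lemma take_subset_touched:
  assumes "t < m" "pol ! t \<noteq> 1"
  shows "set (take (p (pol ! t)) (rank (pol ! t))) \<subseteq> touched p"
  using assms nth_mem[of t pol] by (force simp: touched_def length_pol)

text \<open>A passed prefix consists of distinct touched items, so a pointer at the end of its
  ranking would mean \<open>m\<close> touched items, more than the \<open>t\<close> allocated ones.
  This rules out the default of \<open>opt\<close>.\<close>

lemma pointer_less:
  assumes "t < m" "pol ! t \<noteq> 1" "card (touched p) \<le> t"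
  shows "p (pol ! t) < m"
proof -
  let ?i = "pol ! t"
  have i: "?i \<in> {1..num_agents I}" using assms pol_nth_agent by simp
  have "card (set (take (p ?i) (rank ?i))) = min m (p ?i)"
    using distinct_rank[OF i] length_rank[OF i] by (simp add: distinct_card)
  with card_mono[OF finite_touched take_subset_touched[OF assms(1,2), of p]] assms
  show ?thesis by simp
qed

lemma the_item_mem:
  assumes "t < m" "p (pol ! t) < m"
  shows "the_item t p \<in> {1..m}"
proof -
  have i: "pol ! t \<in> {1..num_agents I}" using assms pol_nth_agent by simp
  show ?thesis
    using nth_mem[of "p (pol ! t)" "rank (pol ! t)"] length_rank[OF i] set_rank[OF i] assms
    by (simp add: the_item_def)
qed

lemma drop_pol: "t < m \<Longrightarrow> drop t pol = pol ! t # drop (Suc t) pol"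
  by (simp add: Cons_nth_drop_Suc length_pol)

text \<open>
  Items allocated but not yet passed by the pointers are held by the manipulator, so an untouched
  item that has been allocated witnesses that leaving it to the manipulator is a permitted move.
\<close>

lemma opt_cost_le:
  assumes P: "P 1 = \<sigma>" "\<And>i. i \<noteq> 1 \<Longrightarrow> P i = rank i" and "set \<sigma> = {1..m}"
    and "R \<subseteq> {1..m}" "card R = m - t" "t \<le> m" "touched p \<inter> R = {}"
  shows "cost (snd (opt t p)) \<le> cost (others (allocation P (drop t pol) R))"
  using assms(4-)
proof (induction t p arbitrary: R rule: opt_induct)
  case (finished t p)
  then show ?case by (simp add: opt_unfold[of t] length_pol)
next
  case (manipulator t p)
  define g where "g = first_available \<sigma> R"
  have R: "finite R" "R \<noteq> {}"
    using manipulator by (auto intro: finite_subset)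
  then have g: "g \<in> R" unfolding g_def
    using manipulator.prems assms(3) by (intro first_available_mem) auto
  have "cost (snd (opt (Suc t) p))
      \<le> cost (others (allocation P (drop (Suc t) pol) (R - {g})))"
    using manipulator g R by (intro manipulator.IH) auto
  with manipulator.hyps show ?case
    by (simp add: opt_unfold[of t] drop_pol Let_def g_def P[simplified])
next
  case (stuck t p)
  have "finite R" using stuck.prems(1) finite_subset by blast
  \<comment> \<open>Exactly \<open>t\<close> items are gone and every touched item is among them, so
    this case contradicts \<open>pointer_less\<close>.\<close>
  have "touched p \<subseteq> {1..m} - R" using stuck.prems touched_subset by auto
  from card_mono[OF _ this] have "card (touched p) \<le> t"
    using stuck.prems \<open>finite R\<close> by (simp add: card_Diff_subset)
  with pointer_less stuck.hyps show ?case by fastforce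
next
  case (skip t p)
  have "touched (bump t p) = touched p"
    using touched_bump skip by auto
  then have "cost (snd (opt t (bump t p)))
      \<le> cost (others (allocation P (drop t pol) R))"
    using skip by (intro skip.IH) auto
  with skip.hyps show ?case by (simp add: opt_unfold[of t p])
next
  case (pick t p)
  define x where "x = the_item t p"
  have fin: "finite R" using pick.prems(1) finite_subset by blast
  have x: "x \<in> {1..m}" using the_item_mem pick.hyps by (simp add: x_def)
  have tb: "touched (bump t p) = insert x (touched p)"
    using touched_bump pick.hyps by (simp add: x_def)
  \<comment> \<open>\<open>opt\<close> selects the cheaper permitted outcome, so it is bounded by
    either one, whatever the actual play does.\<close>
  have le_take: "cost (snd (opt t p)) \<le> u x + cost (snd (opt (Suc t) (bump t p)))"
    using pick.hyps by (subst opt_unfold) (auto simp: leaves_def x_def)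
  have le_leave: "cost (snd (opt t p)) \<le> cost (snd (opt t (bump t p)))" if "card (touched p) < t"
    using pick.hyps that by (subst opt_unfold) (auto simp: leaves_def x_def)
  show ?case
  proof (cases "x \<in> R")
    case True
    have "first_available (rank (pol ! t)) R = rank (pol ! t) ! p (pol ! t)"
    proof (rule first_available_nth)
      show "p (pol ! t) < length (rank (pol ! t))"
        using pick.hyps pol_nth_agent length_rank by simp
      show "rank (pol ! t) ! p (pol ! t) \<in> R"
        using True by (simp add: x_def the_item_def)
      show "set (take (p (pol ! t)) (rank (pol ! t))) \<inter> R = {}"
        using take_subset_touched[of t p] pick by auto
    qed
    then have "first_available (rank (pol ! t)) R = x"
      by (simp add: x_def the_item_def)
    moreover have "cost (snd (opt (Suc t) (bump t p)))
        \<le> cost (others (allocation P (drop (Suc t) pol) (R - {x})))"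
      using pick.prems pick.hyps True fin tb by (intro pick.IH(2)) auto
    ultimately show ?thesis
      using le_take pick.hyps by (simp add: drop_pol Let_def P[simplified])
  next
    case False
    have "insert x (touched p) \<subseteq> {1..m} - R"
      using False x pick.prems touched_subset by auto
    from card_mono[OF _ this] have "card (touched p) < t"
      using pick.prems pick.hyps fin by (simp add: card_Diff_subset x_def)
    moreover have "cost (snd (opt t (bump t p)))
        \<le> cost (others (allocation P (drop t pol) R))"
      using pick.prems pick.hyps False tb by (intro pick.IH(1)) auto
    ultimately show ?thesis using le_leave by linarith
  qed
qed

text \<open>An item is recorded only while untouched and becomes touched at that moment, so none is
  recorded twice.\<close>

lemma opt_lists:
  "set (fst (opt t p)) \<union> set (snd (opt t p)) \<subseteq> {1..m} - touched p \<and>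
   distinct (fst (opt t p) @ snd (opt t p))"
proof (induction t p rule: opt_induct)
  case (pick t p)
  have "touched (bump t p) = insert (the_item t p) (touched p)"
    using touched_bump pick.hyps by simp
  with pick the_item_mem[of t p] show ?case
    by (subst (1 2 3 4) opt_unfold) auto
next
  case (skip t p)
  have "touched (bump t p) = touched p"
    using touched_bump[of t p] skip.hyps by auto
  with skip show ?case
    by (subst (1 2 3 4) opt_unfold) auto
next
  case (manipulator t p)
  then show ?case by (subst (1 2 3 4) opt_unfold) simp
next
  case (finished t p)
  then show ?case by (subst (1 2 3 4) opt_unfold) simp
next
  case (stuck t p)
  then show ?case by (subst (1 2 3 4) opt_unfold) simp
qed

text \<open>Leaving an item requires strictly fewer than \<open>t\<close> touched items, so
  \<open>card (touched p) \<le> t\<close> survives every move and the recursion ends at time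
  \<open>m\<close> rather than at the default. The count fixes where \<open>N\<close> begins in the
  strategy.\<close>

lemma length_opt_others:
  assumes "card (touched p) \<le> t"
  shows "length (snd (opt t p)) = length (filter (\<lambda>i. i \<noteq> 1) (drop t pol))"
  using assms
proof (induction t p rule: opt_induct)
  case (finished t p)
  then show ?case by (simp add: opt_unfold length_pol)
next
  case (manipulator t p)
  then show ?case by (simp add: opt_unfold[of t] drop_pol)
next
  case (stuck t p)
  then show ?case using pointer_less by fastforce
next
  case (skip t p)
  have "touched (bump t p) = touched p"
    using touched_bump[of t p] skip.hyps by auto
  with skip show ?case by (subst opt_unfold) auto
next
  case (pick t p)
  have "touched (bump t p) = insert (the_item t p) (touched p)"
    using touched_bump pick.hyps by simp
  then have c: "card (touched (bump t p)) = Suc (card (touched p))"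
    using pick.hyps by simp
  show ?case
  proof (cases "leaves t p")
    case True
    then have "card (touched p) < t" by (simp add: leaves_def)
    with pick c True show ?thesis by (subst opt_unfold) auto
  next
    case False
    with pick c show ?thesis by (subst opt_unfold) (auto simp: drop_pol)
  qed
qed

text \<open>
  The manipulator receives the untouched items \<open>U\<close> last; \<open>N\<close> contributes nothing, since the
  manipulator's turns are exhausted before \<open>N\<close> is reached.
\<close>

lemma others_of_opt_strategy:
  assumes P: "P 1 = \<sigma>" "\<And>i. i \<noteq> 1 \<Longrightarrow> P i = rank i"
    and \<sigma>: "\<sigma> = pre @ fst (opt t p) @ U @ N" "distinct \<sigma>" "set \<sigma> = {1..m}"
    and N: "set (snd (opt t p)) \<subseteq> set N" "taken \<subseteq> set N"
    and "touched p = set pre \<union> taken"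
    and "length pre \<le> q" "q + card taken = t" "t \<le> m"
    and turns: "q + length (filter (\<lambda>i. i = 1) (drop t pol)) = m - length N"
    and R: "R = {1..m} - taken - set (take q \<sigma>)"
  shows "others (allocation P (drop t pol) R) = snd (opt t p)"
  using assms(3,6-)
proof (induction t p arbitrary: pre q taken R rule: opt_induct)
  case (finished t p)
  then show ?case by (simp add: opt_unfold[of t] length_pol)
next
  case (manipulator t p)
  have o: "opt t p = opt (Suc t) p"
    using manipulator.hyps by (subst opt_unfold) simp
  define M where "M = m - length N"
  have len: "length \<sigma> = m" using \<sigma>(2,3) distinct_card by fastforce
  have N': "N = drop M \<sigma>"
    using len manipulator.prems(1) unfolding M_def by simp
  \<comment> \<open>The current turn is counted in \<open>turns\<close>, so the next entry of
    \<open>\<sigma>\<close> lies before \<open>N\<close>; as \<open>taken\<close> is inside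
    \<open>N\<close>, that entry is still available.\<close>
  have q: "q < M" "M \<le> m" using manipulator.prems(8) manipulator.hyps
    by (auto simp: M_def drop_pol)
  have "\<sigma> ! q \<notin> set N"
    using q len \<sigma>(2) unfolding N' by (auto simp: in_set_conv_nth nth_eq_iff_index_eq)
  moreover have "\<sigma> ! q \<notin> set (take q \<sigma>)"
    using q len \<sigma>(2) by (auto simp: in_set_conv_nth nth_eq_iff_index_eq)
  moreover have "\<sigma> ! q \<in> {1..m}"
    using q len \<sigma>(3) nth_mem[of q \<sigma>] by simp
  ultimately have "\<sigma> ! q \<in> R"
    using manipulator.prems(3,9) by auto
  then have fa: "first_available \<sigma> R = \<sigma> ! q"
    using q len manipulator.prems(9) by (intro first_available_nth) auto
  have "others (allocation P (drop (Suc t) pol) (R - {\<sigma> ! q})) = snd (opt (Suc t) p)"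
  proof (rule manipulator.IH[where pre = pre and q = "Suc q" and taken = taken])
    show "R - {\<sigma> ! q} = {1..m} - taken - set (take (Suc q) \<sigma>)"
      using q len manipulator.prems(9) by (auto simp: take_Suc_conv_app_nth)
  qed (use manipulator.prems manipulator.hyps o in \<open>auto simp: drop_pol\<close>)
  with manipulator.hyps fa show ?case
    by (simp add: o drop_pol Let_def P[simplified])
next
  case (stuck t p)
  have "card (touched p) \<le> card (set pre) + card taken"
    unfolding stuck.prems(4) by (rule card_Un_le)
  also have "\<dots> \<le> t" using stuck.prems(5,6) card_length[of pre] by linarith
  finally show ?case using pointer_less[OF stuck.hyps(1,2), of p] stuck.hyps(3) by simp
next
  case (skip t p)
  have "touched (bump t p) = touched p"
    using touched_bump[of t p] skip.hyps by auto
  moreover have o: "opt t p = opt t (bump t p)"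
    using skip.hyps by (subst opt_unfold) simp
  ultimately have "others (allocation P (drop t pol) R) = snd (opt t (bump t p))"
    by (intro skip.IH[where pre = pre and taken = taken and q = q]) (use skip.prems in simp_all)
  then show ?case using o by simp
next
  case (pick t p)
  define x where "x = the_item t p"
  define M where "M = m - length N"
  have len: "length \<sigma> = m" using \<sigma>(2,3) distinct_card by fastforce
  have N': "N = drop M \<sigma>"
    using len pick.prems(1) unfolding M_def by simp
  have qM: "q \<le> M" "M \<le> m" using pick.prems(8) by (auto simp: M_def)
  have x: "x \<in> {1..m}" "x \<notin> touched p"
    using the_item_mem pick.hyps by (auto simp: x_def)
  have tb: "touched (bump t p) = insert x (touched p)"
    using touched_bump pick.hyps by (simp add: x_def)
  have fin: "finite taken" using pick.prems(3) finite_subset by blast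
  have disj: "set pre \<inter> taken = {}" using \<sigma>(2) pick.prems(1,3) by auto
  have "distinct pre" using \<sigma>(2) pick.prems(1) by auto
  then have card_touched: "card (touched p) = length pre + card taken"
    using pick.prems(4) disj fin by (simp add: card_Un_disjoint distinct_card)
  have pre: "set pre \<subseteq> set (take q \<sigma>)"
    using pick.prems(1,5) by simp
  show ?case
  proof (cases "leaves t p")
    case True
    then have o: "opt t p = apfst ((#) x) (opt t (bump t p))"
      using pick.hyps by (subst opt_unfold) (simp add: x_def)
    have "card (touched p) < t" using True by (simp add: leaves_def)
    have "others (allocation P (drop t pol) R) = snd (opt t (bump t p))"
    proof (rule pick.IH(1)[where pre = "pre @ [x]" and q = q and taken = taken])
      \<comment> \<open>By \<open>card_touched\<close> the test in \<open>leaves\<close> reads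
        \<open>length pre < q\<close>, so \<open>x\<close>, at position \<open>length pre\<close> of
        \<open>\<sigma>\<close>, has already been picked.\<close>
      show "length (pre @ [x]) \<le> q"
        using \<open>card (touched p) < t\<close> card_touched pick.prems(6) by simp
      show "\<sigma> = (pre @ [x]) @ fst (opt t (bump t p)) @ U @ N"
        using pick.prems(1) o by simp
      show "set (snd (opt t (bump t p))) \<subseteq> set N"
        using pick.prems(2) o by simp
      show "touched (bump t p) = set (pre @ [x]) \<union> taken"
        using pick.prems(4) tb by simp
    qed (fact pick.prems)+
    then show ?thesis by (simp add: o)
  next
    case False
    then have o: "opt t p = apsnd ((#) x) (opt (Suc t) (bump t p))"
      using pick.hyps by (subst opt_unfold) (simp add: x_def)
    \<comment> \<open>Being untouched, \<open>x\<close> is not in \<open>taken\<close>; being in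
      \<open>N\<close>, it is not among the first \<open>q\<close> picks. So it is available and the
      agent really takes it.\<close>
    have "x \<in> set N" using o pick.prems(2) by simp
    have "set (take q \<sigma>) \<inter> set N = {}"
      using set_take_disj_set_drop_if_distinct[OF \<sigma>(2) qM(1)] unfolding N'[symmetric] .
    then have "x \<in> R"
      unfolding pick.prems(9) using \<open>x \<in> set N\<close> x pick.prems(4) by blast
    moreover have "set (take (p (pol ! t)) (rank (pol ! t))) \<inter> R = {}"
      unfolding pick.prems(9)
      using take_subset_touched[OF pick.hyps(1,2), of p] pre pick.prems(4) by blast
    moreover have "p (pol ! t) < length (rank (pol ! t))"
      using pick.hyps pol_nth_agent length_rank by simp
    ultimately have fa: "first_available (rank (pol ! t)) R = x"
      using first_available_nth[of "p (pol ! t)" "rank (pol ! t)" R]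
      by (simp add: x_def the_item_def)
    have "others (allocation P (drop (Suc t) pol) (R - {x})) =
        snd (opt (Suc t) (bump t p))"
    proof (rule pick.IH(2)[where pre = pre and q = q and taken = "insert x taken"])
      show "q + card (insert x taken) = Suc t"
        using x pick.prems(4,6) fin by (simp add: card_insert_if)
      show "q + length (filter (\<lambda>i. i = 1) (drop (Suc t) pol)) = m - length N"
        using pick.prems(8) pick.hyps by (simp add: drop_pol)
      show "R - {x} = {1..m} - insert x taken - set (take q \<sigma>)"
        using pick.prems(9) by auto
      show "\<sigma> = pre @ fst (opt (Suc t) (bump t p)) @ U @ N"
        using pick.prems(1) o by simp
      show "set (snd (opt (Suc t) (bump t p))) \<subseteq> set N"
        using pick.prems(2) o by simp
      show "touched (bump t p) = set pre \<union> insert x taken"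
        using pick.prems(4) tb by simp
      show "insert x taken \<subseteq> set N"
        using pick.prems(3) \<open>x \<in> set N\<close> by simp
      show "Suc t \<le> m" using pick.hyps(1) by simp
    qed (fact pick.prems)+
    with fa pick.hyps show ?thesis by (simp add: drop_pol o Let_def P[simplified])
  qed
qed

lemma manipulator_utility_eq:
  assumes "set \<sigma> = {1..m}"
  shows "manipulator_utility I \<sigma> =
    (\<Sum>g = 1..m. u g) - cost (others (allocation (rank(1 := \<sigma>)) pol {1..m}))"
proof -
  let ?a = "allocation (rank(1 := \<sigma>)) pol {1..m}"
  have *: "set (map snd ?a) = {1..m} \<and> distinct (map snd ?a)"
    using assms set_rank pol_agent by (intro allocation_items) (auto simp: length_pol)
  have d: "distinct (others ?a)"
    using * by (auto simp: others_def distinct_map_filter)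
  have "manipulator_bundle I \<sigma> = snd ` set ?a - set (others ?a)"
    using first_agent_items[of ?a] * by (simp add: manipulator_bundle_def items_def)
  then have "manipulator_bundle I \<sigma> = {1..m} - set (others ?a)"
    using * by simp
  moreover have "set (others ?a) \<subseteq> {1..m}"
    using * by (auto simp: others_def)
  moreover have "cost (others ?a) = (\<Sum>g \<in> set (others ?a). u g)"
    using d by (simp add: cost_def sum_list_distinct_conv_sum_set)
  ultimately show ?thesis
    by (simp add: manipulator_utility_def sum_diff)
qed

text \<open>The inner order of \<open>U\<close> and \<open>N\<close> is free, which lets the program
  append both by increasing index.\<close>

theorem best_response_opt:
  assumes "\<sigma> = fst (opt 0 (\<lambda>_. 0)) @ U @ N" "distinct \<sigma>" "set \<sigma> = {1..m}"
    and "set N = set (snd (opt 0 (\<lambda>_. 0)))"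
  shows "best_response I \<sigma>"
  unfolding best_response_def
proof (intro conjI ballI)
  let ?p = "\<lambda>_ :: nat. 0 :: nat"
  have t0: "touched ?p = {}" by (simp add: touched_def)
  show "\<sigma> \<in> permutations_of_set (items I)"
    using assms by (simp add: permutations_of_set_def items_def)
  have "distinct N" using assms(1,2) by simp
  moreover have "distinct (snd (opt 0 ?p))" using opt_lists[of 0 ?p] by simp
  \<comment> \<open>The others have \<open>length N\<close> turns, so the manipulator's turns run
    out exactly where \<open>N\<close> begins.\<close>
  ultimately have "length N = length (filter (\<lambda>i. i \<noteq> 1) pol)"
    using length_opt_others[of ?p 0] t0 assms(4) by (metis card.empty distinct_card drop0 le0)
  then have "length (filter (\<lambda>i. i = 1) pol) = m - length N"
    using sum_length_filter_compl[of "\<lambda>i. i = 1" pol] length_pol by simp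
  then have "others (allocation (rank(1 := \<sigma>)) (drop 0 pol) {1..m}) = snd (opt 0 ?p)"
    using assms t0
    by (intro others_of_opt_strategy[where pre = "[]" and q = 0 and taken = "{}" and U = U and N = N
        and \<sigma> = \<sigma>])
      auto
  then have eq: "manipulator_utility I \<sigma> = (\<Sum>g = 1..m. u g) - cost (snd (opt 0 ?p))"
    using manipulator_utility_eq assms by simp
  fix \<sigma>' assume "\<sigma>' \<in> permutations_of_set (items I)"
  then have \<sigma>': "set \<sigma>' = {1..m}" by (simp add: permutations_of_set_def items_def)
  have "cost (snd (opt 0 ?p)) \<le> cost (others (allocation (rank(1 := \<sigma>')) (drop 0 pol) {1..m}))"
    using \<sigma>' t0 by (intro opt_cost_le[where \<sigma> = \<sigma>']) auto
  then show "manipulator_utility I \<sigma>' \<le> manipulator_utility I \<sigma>"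
    using eq manipulator_utility_eq[OF \<sigma>'] by simp
qed

end

section \<open>Timed weakest preconditions\<close>

text \<open>
  The number \<open>k\<close> is the time spent so far, and \<open>Q\<close> speaks about the final state and the total time,
  so costs accumulate along a program without any subtraction.
\<close>

definition wp :: "com \<Rightarrow> state \<Rightarrow> nat \<Rightarrow> (state \<Rightarrow> nat \<Rightarrow> bool) \<Rightarrow> bool" where
  "wp c s k Q \<longleftrightarrow> (\<exists>l t. exec c s l t \<and> Q t (k + l))"

lemma wp_Skip: "wp Skip s k Q \<longleftrightarrow> Q s (Suc k)"
  by (auto simp: wp_def elim!: SkipE intro: exec.Skip)
    (metis One_nat_def Suc_eq_plus1 add.commute exec.Skip plus_1_eq_Suc)

lemma wp_NAssign:
  "wp (NAssign a e f) s k Q \<longleftrightarrow>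
     Q (nwrite a (nval e s) (nval f s) s) (k + (1 + ncost e + ncost f))"
  unfolding wp_def by (metis NAssignE exec.NAssign)

lemma wp_RAssign:
  "wp (RAssign a e f) s k Q \<longleftrightarrow>
     Q (rwrite a (nval e s) (rval f s) s) (k + (1 + ncost e + rcost f))"
  unfolding wp_def by (metis RAssignE exec.RAssign)

lemma wp_Seq: "wp (Seq c d) s k Q \<longleftrightarrow> wp c s (Suc k) (\<lambda>t l. wp d t l Q)"
proof
  assume "wp (Seq c d) s k Q"
  then show "wp c s (Suc k) (\<lambda>t l. wp d t l Q)"
    unfolding wp_def by (auto elim!: SeqE simp: ac_simps) (metis add.assoc)
next
  assume "wp c s (Suc k) (\<lambda>t l. wp d t l Q)"
  then obtain l t l' t' where "exec c s l t" "exec d t l' t'" "Q t' (Suc k + l + l')"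
    unfolding wp_def by auto
  with exec.Seq[of c s l t d l' t'] show "wp (Seq c d) s k Q"
    unfolding wp_def by (auto simp: ac_simps intro!: exI[of _ "Suc (l + l')"] exI[of _ t'])
qed

lemma wp_Cond:
  "wp (Cond b c d) s k Q \<longleftrightarrow>
     (if bval b s then wp c s (k + (1 + bcost b)) Q else wp d s (k + (1 + bcost b)) Q)"
proof
  assume "wp (Cond b c d) s k Q"
  then show "if bval b s then wp c s (k + (1 + bcost b)) Q else wp d s (k + (1 + bcost b)) Q"
    by (auto simp: wp_def add.assoc elim!: CondE) blast+
next
  assume *: "if bval b s then wp c s (k + (1 + bcost b)) Q else wp d s (k + (1 + bcost b)) Q"
  show "wp (Cond b c d) s k Q"
  proof (cases "bval b s")
    case True
    with * obtain l t where "exec c s l t" "Q t (k + (1 + bcost b + l))"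
      by (auto simp: wp_def add.assoc)
    with exec.CondTrue[OF True] show ?thesis unfolding wp_def by blast
  next
    case False
    with * obtain l t where "exec d s l t" "Q t (k + (1 + bcost b + l))"
      by (auto simp: wp_def add.assoc)
    with exec.CondFalse[OF False] show ?thesis unfolding wp_def by blast
  qed
qed

lemmas wp_simps = wp_Skip wp_NAssign wp_RAssign wp_Seq wp_Cond

lemma wp_mono:
  assumes "wp c s k Q" "\<And>t l. Q t l \<Longrightarrow> Q' t l"
  shows "wp c s k Q'"
  using assms by (auto simp: wp_def)

text \<open>\<open>\<mu>\<close> bounds the number of iterations and \<open>T\<close> the cost of
  one body; the test is charged per iteration and once more at the exit. In \<open>step\<close> the
  starting time \<open>l\<close> is arbitrary, so a body is analysed without knowing how much time
  has passed.\<close>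

lemma wp_While:
  assumes "Inv s"
    and step: "\<And>t l. Inv t \<Longrightarrow> bval b t \<Longrightarrow>
      wp c t l (\<lambda>t' l'. Inv t' \<and> \<mu> t' < \<mu> t \<and> l' \<le> l + T)"
    and final: "\<And>t l. Inv t \<Longrightarrow> \<not> bval b t \<Longrightarrow>
      l \<le> k + (\<mu> s * (T + (1 + bcost b)) + (1 + bcost b)) \<Longrightarrow> Q t l"
  shows "wp (While b c) s k Q"
proof -
  have "\<exists>l t. exec (While b c) s l t \<and> Inv t \<and> \<not> bval b t \<and>
      l \<le> \<mu> s * (T + (1 + bcost b)) + (1 + bcost b)" (is "\<exists>l t. ?P s l t")
    using assms(1)
  proof (induction "\<mu> s" arbitrary: s rule: less_induct)
    case less
    show ?case
    proof (cases "bval b s")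
      case True
      from step[OF less.prems True, of 0] obtain l t
        where t: "exec c s l t" "Inv t" "\<mu> t < \<mu> s" "l \<le> T"
        by (auto simp: wp_def)
      from less.hyps[OF t(3,2)] obtain l' t' where t': "?P t l' t'" by blast
      have "Suc (\<mu> t) * (T + (1 + bcost b)) \<le> \<mu> s * (T + (1 + bcost b))"
        using t(3) by (intro mult_le_mono1) simp
      then have "1 + bcost b + l + l' \<le> \<mu> s * (T + (1 + bcost b)) + (1 + bcost b)"
        using t(4) t' by simp
      moreover have "exec (While b c) s (1 + bcost b + l + l') t'"
        using True t(1) t' by (intro exec.WhileTrue) auto
      ultimately show ?thesis using t' by blast
    next
      case False
      with less.prems exec.WhileFalse[of b s c] show ?thesis
        by (intro exI[of _ "1 + bcost b"] exI[of _ s]) auto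
    qed
  qed
  with final show ?thesis unfolding wp_def by fastforce
qed

lemma nmem_nwrite [simp]: "nmem (nwrite a i v s) = (nmem s)(a := (nmem s a)(i := v))"
  and rmem_nwrite [simp]: "rmem (nwrite a i v s) = rmem s"
  and nmem_rwrite [simp]: "nmem (rwrite a i x s) = nmem s"
  and rmem_rwrite [simp]: "rmem (rwrite a i x s) = (rmem s)(a := (rmem s a)(i := x))"
  by (simp_all add: nwrite_def rwrite_def)

section \<open>The program\<close>

abbreviation scalar :: "nat \<Rightarrow> nexp" where
  "scalar x \<equiv> NArr x (Const 0)"

abbreviation assign :: "nat \<Rightarrow> nexp \<Rightarrow> com" where
  "assign x e \<equiv> NAssign x (Const 0) e"

abbreviation Seq_infix :: "com \<Rightarrow> com \<Rightarrow> com" (infixr ";;" 60) where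
  "c ;; d \<equiv> Seq c d"

text \<open>
  A name starting with \<open>v\<close> denotes an array of which only cell 0 is used, as a scalar variable.
  Only agents occurring in the policy get a digit in the code of a state: \<open>aAgent\<close> lists them and
  \<open>aWeight\<close> holds the weights of their digits. The arrays \<open>aNext\<close>, \<open>aAct\<close>, \<open>aItem\<close> and the real
  array 1 are indexed by codes: successor, kind of move (1 leaves the item \<open>aItem\<close> to the
  manipulator, 2 takes it) and optimal cost.
\<close>

abbreviation (input) "vM \<equiv> NArr 0 (Const 0)"
abbreviation (input) "vN \<equiv> NArr 0 (Const 1)"
abbreviation (input) "aOut \<equiv> 3 :: nat"
abbreviation (input) "vI \<equiv> 4 :: nat"
abbreviation (input) "vK \<equiv> 5 :: nat"
abbreviation (input) "vTot \<equiv> 6 :: nat"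
abbreviation (input) "aWeight \<equiv> 7 :: nat"
abbreviation (input) "aAgent \<equiv> 8 :: nat"
abbreviation (input) "aBase \<equiv> 9 :: nat"
abbreviation (input) "vAcc \<equiv> 10 :: nat"
abbreviation (input) "vCode \<equiv> 11 :: nat"
abbreviation (input) "vRem \<equiv> 12 :: nat"
abbreviation (input) "vCnt \<equiv> 13 :: nat"
abbreviation (input) "vJ \<equiv> 14 :: nat"
abbreviation (input) "vA \<equiv> 15 :: nat"
abbreviation (input) "vQ \<equiv> 16 :: nat"
abbreviation (input) "vX \<equiv> 17 :: nat"
abbreviation (input) "aMark \<equiv> 18 :: nat"
abbreviation (input) "aPtr \<equiv> 19 :: nat"
abbreviation (input) "aNext \<equiv> 20 :: nat"
abbreviation (input) "aAct \<equiv> 21 :: nat"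
abbreviation (input) "aItem \<equiv> 22 :: nat"
abbreviation (input) "vLen \<equiv> 23 :: nat"
abbreviation (input) "aFlag \<equiv> 24 :: nat"
abbreviation (input) "vC' \<equiv> 25 :: nat"

text \<open>\<open>aBase\<close> holds the offset of each ranking in array 2, accumulated by
  addition.\<close>

definition bases :: com where
  "bases =
     assign vI (Const 1) ;;
     While (NLess (scalar vI) (NAdd vN (Const 1)))
      (NAssign aBase (scalar vI) (scalar vAcc) ;;
       assign vAcc (NAdd (scalar vAcc) vM) ;;
       assign vI (NAdd (scalar vI) (Const 1)))"

text \<open>There is no multiplication, so the next weight is obtained by adding up \<open>m + 1\<close> copies.\<close>

definition next_weight :: com where
  "next_weight =
     assign vAcc (Const 0) ;;
     assign vQ (Const 0) ;;
     While (NLess (scalar vQ) (NAdd vM (Const 1)))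
      (assign vAcc (NAdd (scalar vAcc) (scalar vTot)) ;;
       assign vQ (NAdd (scalar vQ) (Const 1))) ;;
     assign vTot (scalar vAcc)"

text \<open>Weight 1 belongs to the clock \<open>t\<close>, so the first listed agent gets
  \<open>m + 1\<close>. Weight 0 doubles as the sign of an agent not listed yet. At the end
  \<open>vTot\<close> is the number of codes.\<close>

definition weights :: com where
  "weights =
     assign vTot (NAdd vM (Const 1)) ;;
     assign vI (Const 0) ;;
     While (NLess (scalar vI) vM)
      (assign vA (NArr 1 (scalar vI)) ;;
       Cond (Conj (NLess (Const 1) (scalar vA)) (NLess (NArr aWeight (scalar vA)) (Const 1)))
        (NAssign aAgent (scalar vK) (scalar vA) ;;
         NAssign aWeight (scalar vA) (scalar vTot) ;;
         assign vK (NAdd (scalar vK) (Const 1)) ;;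
         next_weight)
        Skip ;;
       assign vI (NAdd (scalar vI) (Const 1)))"

text \<open>
  Codes are visited in decreasing order, so \<open>vTot - vCode\<close> is a fresh time stamp: an item is touched
  in the current state iff its mark equals this stamp, and no clearing is needed.
\<close>

definition scan :: com where
  "scan =
     While (Neg (NLess (scalar vRem) (NArr aWeight (scalar vA))))
      (assign vRem (NSub (scalar vRem) (NArr aWeight (scalar vA))) ;;
       assign vX (NArr 2 (NAdd (NArr aBase (scalar vA)) (scalar vQ))) ;;
       Cond (NLess (NArr aMark (scalar vX)) (NSub (scalar vTot) (scalar vCode)))
        (NAssign aMark (scalar vX) (NSub (scalar vTot) (scalar vCode)) ;;
         assign vCnt (NAdd (scalar vCnt) (Const 1)))
        Skip ;;
       assign vQ (NAdd (scalar vQ) (Const 1)))"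

text \<open>The most significant digit is removed first, in unary. Each subtraction in
  \<open>scan\<close> passes one item of a ranking, so reading a pointer and marking its prefix are
  the same loop. What is left in \<open>vRem\<close> is \<open>t\<close>.\<close>

definition decode :: com where
  "decode =
     assign vRem (scalar vCode) ;;
     assign vCnt (Const 0) ;;
     assign vJ (scalar vK) ;;
     While (NLess (Const 0) (scalar vJ))
      (assign vJ (NSub (scalar vJ) (Const 1)) ;;
       assign vA (NArr aAgent (scalar vJ)) ;;
       assign vQ (Const 0) ;;
       scan ;;
       NAssign aPtr (scalar vA) (scalar vQ))"

text \<open>One unfolding of \<open>opt\<close>: adding 1 to the code advances the clock, adding a
  weight advances a pointer. The \<open>Skip\<close> branches rely on zeros in fresh cells, which
  encode cost 0 and no successor.\<close>

definition decide :: com where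
  "decide =
     Cond (NLess (scalar vRem) vM)
      (assign vA (NArr 1 (scalar vRem)) ;;
       Cond (NLess (scalar vA) (Const 2))
        (RAssign 1 (scalar vCode) (RArr 1 (NAdd (scalar vCode) (Const 1))) ;;
         NAssign aNext (scalar vCode) (NAdd (scalar vCode) (Const 1)))
        (assign vQ (NArr aPtr (scalar vA)) ;;
         Cond (NLess (scalar vQ) vM)
          (assign vX (NArr 2 (NAdd (NArr aBase (scalar vA)) (scalar vQ))) ;;
           assign vC' (NAdd (scalar vCode) (NArr aWeight (scalar vA))) ;;
           Cond (NLess (NArr aMark (scalar vX)) (NSub (scalar vTot) (scalar vCode)))
            (NAssign aItem (scalar vCode) (scalar vX) ;;
             Cond (Conj (NLess (scalar vCnt) (scalar vRem))
                (RLess (RArr 1 (scalar vC'))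
                  (RAdd (RArr 0 (scalar vX)) (RArr 1 (NAdd (scalar vC') (Const 1))))))
              (RAssign 1 (scalar vCode) (RArr 1 (scalar vC')) ;;
               NAssign aNext (scalar vCode) (scalar vC') ;;
               NAssign aAct (scalar vCode) (Const 1))
              (RAssign 1 (scalar vCode)
                (RAdd (RArr 0 (scalar vX)) (RArr 1 (NAdd (scalar vC') (Const 1)))) ;;
               NAssign aNext (scalar vCode) (NAdd (scalar vC') (Const 1)) ;;
               NAssign aAct (scalar vCode) (Const 2)))
            (RAssign 1 (scalar vCode) (RArr 1 (scalar vC')) ;;
             NAssign aNext (scalar vCode) (scalar vC')))
          Skip))
      Skip"

definition table :: com where
  "table =
     assign vCode (scalar vTot) ;;
     While (NLess (Const 0) (scalar vCode))
      (assign vCode (NSub (scalar vCode) (Const 1)) ;;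
       decode ;;
       decide)"

text \<open>Successors have positive codes, so 0 in \<open>aNext\<close> marks the end. A move that
  records no item has item 0 and writes to cell 0 of \<open>aFlag\<close>, which belongs to no
  item.\<close>

definition walk :: com where
  "walk =
     assign vCode (Const 0) ;;
     assign vLen (Const 0) ;;
     While (NLess (Const 0) (NArr aNext (scalar vCode)))
      (assign vX (NArr aItem (scalar vCode)) ;;
       NAssign aFlag (scalar vX) (NArr aAct (scalar vCode)) ;;
       Cond (Conj (NLess (Const 0) (NArr aAct (scalar vCode)))
          (NLess (NArr aAct (scalar vCode)) (Const 2)))
        (NAssign aOut (scalar vLen) (scalar vX) ;;
         assign vLen (NAdd (scalar vLen) (Const 1)))
        Skip ;;
       assign vCode (NArr aNext (scalar vCode)))"

definition append_flagged :: "nat \<Rightarrow> com" where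
  "append_flagged f =
     assign vI (Const 1) ;;
     While (NLess (scalar vI) (NAdd vM (Const 1)))
      (Cond (Conj (Neg (NLess (NArr aFlag (scalar vI)) (Const f)))
          (Neg (NLess (Const f) (NArr aFlag (scalar vI)))))
        (NAssign aOut (scalar vLen) (scalar vI) ;;
         assign vLen (NAdd (scalar vLen) (Const 1)))
        Skip ;;
       assign vI (NAdd (scalar vI) (Const 1)))"

text \<open>For \<open>m = 0\<close> the permitted time is a constant, whereas \<open>bases\<close>
  takes time proportional to \<open>n\<close>; hence the test.\<close>

definition best_response_program :: com where
  "best_response_program =
     Cond (NLess (Const 0) vM)
      (bases ;; weights ;; table ;; walk ;; append_flagged 0 ;; append_flagged 2)
      Skip"

section \<open>Codes of states\<close>

context sequential_allocation
begin

abbreviation "n \<equiv> num_agents I"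

primrec horner :: "(nat \<Rightarrow> nat) \<Rightarrow> nat list \<Rightarrow> nat" where
  "horner p [] = 0"
| "horner p (a # as) = p a + Suc m * horner p as"

text \<open>Splits off the most significant digit, the one that \<open>decode\<close> reads
  first.\<close>

lemma horner_snoc: "horner p (as @ [a]) = horner p as + Suc m ^ length as * p a"
  by (induction as) (simp_all add: algebra_simps)

lemma horner_less: "(\<And>a. p a \<le> m) \<Longrightarrow> horner p as < Suc m ^ length as"
proof (induction as)
  case (Cons a as)
  from Cons.IH[OF Cons.prems] have "Suc (horner p as) \<le> Suc m ^ length as" by simp
  from mult_le_mono2[OF this, of "Suc m"] Cons.prems[of a] show ?case by simp
qed simp

lemma horner_cong: "(\<And>a. a \<in> set as \<Longrightarrow> p a = q a) \<Longrightarrow> horner p as = horner q as"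
  by (induction as) auto

lemma horner_bump:
  assumes "distinct as" "j < length as"
  shows "horner (p(as ! j := Suc (p (as ! j)))) as = horner p as + Suc m ^ j"
  using assms
proof (induction as arbitrary: j)
  case (Cons a as)
  show ?case
  proof (cases j)
    case 0
    with Cons.prems have "horner (p(a := Suc (p a))) as = horner p as"
      by (intro horner_cong) auto
    with 0 show ?thesis by (simp add: fun_upd_def)
  next
    case (Suc k)
    with Cons.prems have "as ! k \<noteq> a" by auto
    with Suc Cons show ?thesis by (simp add: algebra_simps fun_upd_def)
  qed
qed simp

lemma horner_inj:
  assumes "\<And>a. p a \<le> m" "\<And>a. q a \<le> m" "horner p as = horner q as" "a \<in> set as"
  shows "p a = q a"
  using assms(3,4)
proof (induction as)
  case (Cons b as)
  have "p b = (p b + Suc m * horner p as) mod Suc m" "horner p as = (p b + Suc m * horner p as) div Suc m"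
    "q b = (q b + Suc m * horner q as) mod Suc m" "horner q as = (q b + Suc m * horner q as) div Suc m"
    using assms(1,2)[of b] by (simp_all only: mod_mult_self2 div_mult_self2 mod_less div_less le_imp_less_Suc)
  with Cons show ?case by (metis horner.simps(2) set_ConsD)
qed simp

lemma horner_surj:
  assumes "distinct as" "c < Suc m ^ length as"
  shows "\<exists>p. (\<forall>a. p a \<le> m) \<and> (\<forall>a. a \<notin> set as \<longrightarrow> p a = 0) \<and> horner p as = c"
  using assms
proof (induction as arbitrary: c)
  case Nil
  then show ?case by (intro exI[of _ "\<lambda>_. 0"]) auto
next
  case (Cons a as)
  have "c div Suc m < Suc m ^ length as"
    using Cons.prems(2) by (simp add: less_mult_imp_div_less mult.commute)
  with Cons obtain p where p: "\<forall>a. p a \<le> m" "\<forall>a. a \<notin> set as \<longrightarrow> p a = 0"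
      "horner p as = c div Suc m" by fastforce
  have "horner (p(a := c mod Suc m)) as = horner p as"
    using Cons.prems(1) by (intro horner_cong) auto
  with p show ?case
    by (intro exI[of _ "p(a := c mod Suc m)"]) (auto simp: less_Suc_eq_le[symmetric] fun_upd_def simp del: mult_Suc)
qed

definition enc :: "nat list \<Rightarrow> nat \<Rightarrow> (nat \<Rightarrow> nat) \<Rightarrow> nat" where
  "enc as t p = t + Suc m * horner p as"

text \<open>Pointers of agents without a digit are pinned to 0; otherwise a code could not determine
  the whole function \<open>p\<close>.\<close>

definition bounded :: "nat list \<Rightarrow> nat \<Rightarrow> (nat \<Rightarrow> nat) \<Rightarrow> bool" where
  "bounded as t p \<longleftrightarrow> t \<le> m \<and> (\<forall>a. p a \<le> m) \<and> (\<forall>a. a \<notin> set as \<longrightarrow> p a = 0)"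

lemma enc_less: "bounded as t p \<Longrightarrow> enc as t p < Suc m ^ Suc (length as)"
  using horner_less[of p as]
    mult_le_mono2[of "Suc (horner p as)" "Suc m ^ length as" "Suc m"]
  by (auto simp: bounded_def enc_def)

lemma enc_inj:
  assumes "bounded as t p" "bounded as t' p'" "enc as t p = enc as t' p'"
  shows "t = t' \<and> p = p'"
proof -
  have "t = (t + Suc m * horner p as) mod Suc m" "horner p as = (t + Suc m * horner p as) div Suc m"
    "t' = (t' + Suc m * horner p' as) mod Suc m" "horner p' as = (t' + Suc m * horner p' as) div Suc m"
    using assms(1,2) unfolding bounded_def
    by (simp_all only: mod_mult_self2 div_mult_self2 mod_less div_less le_imp_less_Suc)
  then have "t = t'" "horner p as = horner p' as"
    using assms(3) unfolding enc_def by metis+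
  moreover have "p a = p' a" for a
    using horner_inj[of p p' as a] calculation assms(1,2) by (cases "a \<in> set as") (auto simp: bounded_def)
  ultimately show ?thesis by auto
qed

lemma enc_surj:
  assumes "distinct as" "c < Suc m ^ Suc (length as)"
  obtains t p where "bounded as t p" "enc as t p = c"
proof -
  have "c div Suc m < Suc m ^ length as"
    using assms(2) by (simp add: less_mult_imp_div_less mult.commute)
  with horner_surj[OF assms(1)] obtain p where "\<forall>a. p a \<le> m" "\<forall>a. a \<notin> set as \<longrightarrow> p a = 0"
    "horner p as = c div Suc m" by blast
  then show ?thesis
    by (intro that[of "c mod Suc m" p])
      (auto simp: bounded_def enc_def less_Suc_eq_le[symmetric] simp del: mult_Suc)
qed

section \<open>Correctness and running time\<close>

definition frame :: "nat set \<Rightarrow> state \<Rightarrow> state \<Rightarrow> bool" where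
  "frame X s t \<longleftrightarrow> rmem t = rmem s \<and> (\<forall>a. a \<notin> X \<longrightarrow> nmem t a = nmem s a)"

definition input_ok :: "state \<Rightarrow> bool" where
  "input_ok s \<longleftrightarrow> nmem s 0 0 = m \<and> nmem s 0 1 = n \<and> (\<forall>j < m. nmem s 1 j = pol ! j) \<and>
     (\<forall>i \<in> {1..n}. \<forall>q < m. nmem s 2 ((i - 1) * m + q) = rank i ! q) \<and>
     (\<forall>g \<in> {1..m}. rmem s 0 g = u g)"

section \<open>Offsets and digit weights\<close>

lemma wp_bases:
  assumes "input_ok s" "nmem s vAcc 0 = 0"
    and "\<And>t l. (\<forall>i \<in> {1..n}. nmem t aBase i = (i - 1) * m) \<Longrightarrow> frame {vI, aBase, vAcc} s t \<Longrightarrow>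
      l \<le> k + 50 * (n + 1) \<Longrightarrow> Q t l"
  shows "wp bases s k Q"
  unfolding bases_def wp_simps
proof (rule wp_While[where T = 30 and \<mu> = "\<lambda>t. n + 1 - nmem t vI 0" and
      Inv = "\<lambda>t. 1 \<le> nmem t vI 0 \<and> nmem t vI 0 \<le> n + 1 \<and> nmem t vAcc 0 = (nmem t vI 0 - 1) * m \<and>
        (\<forall>i \<in> {1..<nmem t vI 0}. nmem t aBase i = (i - 1) * m) \<and> frame {vI, aBase, vAcc} s t"],
      goal_cases)
  case 1
  show ?case using assms(2) by (simp add: frame_def)
next
  case (2 t l)
  then have "nmem t 0 0 = m" "nmem t 0 1 = n"
    using assms(1) by (auto simp: input_ok_def frame_def)
  moreover obtain i where "nmem t vI 0 = Suc i" using 2 by (cases "nmem t vI 0") auto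
  ultimately show ?case
    using 2 by (auto simp: wp_simps frame_def less_Suc_eq)
next
  case (3 t l)
  then have "nmem t 0 1 = n"
    using assms(1) by (auto simp: input_ok_def frame_def)
  with 3 show ?case
    by (intro assms(3)) auto
qed

lemma wp_next_weight:
  assumes "nmem s 0 0 = m"
    and "\<And>t l. nmem t vTot 0 = Suc m * nmem s vTot 0 \<Longrightarrow> frame {vTot, vAcc, vQ} s t \<Longrightarrow>
      l \<le> k + 60 * (m + 1) \<Longrightarrow> Q t l"
  shows "wp next_weight s k Q"
  unfolding next_weight_def wp_simps
proof (rule wp_While[where T = 20 and \<mu> = "\<lambda>t. m + 1 - nmem t vQ 0" and
      Inv = "\<lambda>t. nmem t vQ 0 \<le> m + 1 \<and> nmem t vAcc 0 = nmem t vQ 0 * nmem s vTot 0 \<and>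
        frame {vAcc, vQ} s t"], goal_cases)
  case 1
  show ?case by (simp add: frame_def)
next
  case (2 t l)
  then have "nmem t 0 0 = m" using assms(1) by (auto simp: frame_def)
  with 2 show ?case by (auto simp: wp_simps frame_def)
next
  case (3 t l)
  then have "nmem t 0 0 = m" using assms(1) by (auto simp: frame_def)
  with 3 have "nmem t vQ 0 = Suc m" by simp
  with 3 show ?case by (intro assms(2)) (auto simp: frame_def)
qed

definition weights_ok :: "nat list \<Rightarrow> state \<Rightarrow> bool" where
  "weights_ok as s \<longleftrightarrow> distinct as \<and> nmem s vK 0 = length as \<and>
     nmem s vTot 0 = Suc m ^ Suc (length as) \<and>
     (\<forall>j < length as. nmem s aAgent j = as ! j \<and> nmem s aWeight (as ! j) = Suc m ^ Suc j)"

lemma wp_weights: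
  assumes "input_ok s" "nmem s vK 0 = 0" "nmem s aWeight = (\<lambda>_. 0)"
    and "\<And>t l as. weights_ok as t \<Longrightarrow> set as = set pol - {1} \<Longrightarrow>
      frame {vI, vK, vTot, aWeight, aAgent, vAcc, vA, vQ} s t \<Longrightarrow>
      l \<le> k + 200 * (m + 1) ^ 2 \<Longrightarrow> Q t l"
  shows "wp weights s k Q"
  unfolding weights_def wp_simps
proof (rule wp_While[where T = "60 * (m + 1) + 60" and \<mu> = "\<lambda>t. m - nmem t vI 0" and
      Inv = "\<lambda>t. nmem t vI 0 \<le> m \<and> frame {vI, vK, vTot, aWeight, aAgent, vAcc, vA, vQ} s t \<and>
        (\<exists>as. weights_ok as t \<and> set as = set (take (nmem t vI 0) pol) - {1} \<and>
          (\<forall>a. a \<notin> set as \<longrightarrow> nmem t aWeight a = 0))"], goal_cases)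
  case 1
  have "nmem s 0 0 = m" using assms(1) by (simp add: input_ok_def)
  then show ?case using assms(2,3)
    by (auto simp: frame_def weights_ok_def intro!: exI[of _ "[]"])
next
  case (2 t l)
  define i where "i = nmem t vI 0"
  define a where "a = pol ! i"
  from 2 obtain as where as: "weights_ok as t" "set as = set (take i pol) - {1}"
    "\<And>a. a \<notin> set as \<Longrightarrow> nmem t aWeight a = 0" by (auto simp: i_def)
  have fr: "frame {vI, vK, vTot, aWeight, aAgent, vAcc, vA, vQ} s t" using 2 by simp
  then have mem: "nmem t 0 0 = m" "nmem t 1 = nmem s 1" 
    using assms(1) by (auto simp: frame_def input_ok_def)
  then have i: "i < m" using 2 by (simp add: i_def)
  then have a: "nmem t 1 i = a" using assms(1) mem by (simp add: input_ok_def a_def)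
  have "a \<in> {1..n}" using pol_nth_agent[OF i] by (simp add: a_def)
  have take: "take (Suc i) pol = take i pol @ [a]"
    using i by (simp add: a_def take_Suc_conv_app_nth length_pol)
  \<comment> \<open>Assigned weights are powers of \<open>m + 1\<close>, hence positive, so weight 0
    means that \<open>a\<close> is new.\<close>
  have w0: "nmem t aWeight a < 1 \<longleftrightarrow> a \<notin> set as"
    using as(1,3) by (force simp: weights_ok_def in_set_conv_nth)
  show ?case
  proof (cases "1 < a \<and> a \<notin> set as")
    case True
    then have new: "set (as @ [a]) = set (take (Suc i) pol) - {1}"
      using as(2) take by auto
    have cond: "bval (Conj (NLess (Const 1) (scalar vA)) (NLess (NArr aWeight (scalar vA)) (Const 1)))
        (nwrite vA 0 a t)"
      using True w0 by simp
    show ?thesis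
      using a cond unfolding wp_simps i_def
    proof (simp, elim conjE, intro wp_next_weight, goal_cases)
      case 1
      then show ?case by (simp add: mem)
    next
      case (2 t' l')
      have w: "nmem t' aWeight = (nmem t aWeight)(a := nmem t vTot 0)"
        and a': "nmem t' aAgent = (nmem t aAgent)(nmem t vK 0 := a)"
        and k: "nmem t' vK 0 = Suc (nmem t vK 0)" and i': "nmem t' vI 0 = i"
        using 2 by (auto simp: frame_def i_def)
      have "weights_ok (as @ [a]) t'"
        using as(1) 2 True by (auto simp: weights_ok_def w a' k nth_append less_Suc_eq nth_eq_iff_index_eq)
      then have "weights_ok (as @ [a]) (nwrite vI 0 (Suc i) t')"
        by (simp add: weights_ok_def)
      moreover have "\<forall>b. b \<notin> set (as @ [a]) \<longrightarrow> nmem t' aWeight b = 0"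
        using as(3) by (simp add: w)
      moreover have "frame {vI, vK, vTot, aWeight, aAgent, vAcc, vA, vQ} s (nwrite vI 0 (Suc i) t')"
        using 2 fr by (auto simp: frame_def)
      moreover have "l' + 10 \<le> l + (60 * (m + 1) + 60)" using 2 by simp
      ultimately show ?case
        unfolding wp_simps i_def[symmetric]
        by (intro conjI exI[of _ "as @ [a]"]) (use i i' in \<open>simp_all add: new del: set_append\<close>)
    qed
  next
    case False
    then have "a = 1 \<or> a \<in> set as" using \<open>a \<in> {1..n}\<close> by auto
    then have new: "set as = set (take (Suc i) pol) - {1}"
      unfolding take using as(2) by auto
    have cond: "\<not> bval (Conj (NLess (Const 1) (scalar vA))
        (NLess (NArr aWeight (scalar vA)) (Const 1))) (nwrite vA 0 a t)"
      using False w0 by simp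
    have "weights_ok as (nwrite vI 0 (Suc i) (nwrite vA 0 a t))"
      using as(1) by (simp add: weights_ok_def)
    moreover have "frame {vI, vK, vTot, aWeight, aAgent, vAcc, vA, vQ} s
        (nwrite vI 0 (Suc i) (nwrite vA 0 a t))"
      using fr by (simp add: frame_def)
    moreover have "\<forall>b. b \<notin> set as \<longrightarrow> nmem t aWeight b = 0" using as(3) by simp
    ultimately have "\<exists>as. weights_ok as (nwrite vI 0 (Suc i) (nwrite vA 0 a t)) \<and>
        set as = set (take (Suc i) pol) - {1} \<and> (\<forall>b. b \<notin> set as \<longrightarrow> nmem t aWeight b = 0)"
      "frame {vI, vK, vTot, aWeight, aAgent, vAcc, vA, vQ} s (nwrite vI 0 (Suc i) (nwrite vA 0 a t))"
      using new by blast+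
    then show ?thesis
      using cond a i by (auto simp: wp_simps i_def[symmetric])
  qed
next
  case (3 t l)
  then have "nmem t 0 0 = m"
    using assms(1) by (auto simp: input_ok_def frame_def)
  with 3 have "nmem t vI 0 = m" by auto
  with 3 obtain as where "weights_ok as t" "set as = set pol - {1}"
    by (auto simp: length_pol)
  moreover have "l \<le> k + 200 * (m + 1) ^ 2"
    using 3 by (simp add: power2_eq_square algebra_simps)
  ultimately show ?case using 3 by (intro assms(4)) auto
qed

section \<open>Decoding a state\<close>

definition ready :: "nat list \<Rightarrow> state \<Rightarrow> bool" where
  "ready as s \<longleftrightarrow> input_ok s \<and> (\<forall>i \<in> {1..n}. nmem s aBase i = (i - 1) * m) \<and>
     weights_ok as s \<and> set as = set pol - {1}"

lemma ready_cong:
  assumes "ready as s" "\<And>a. a \<in> {0, 1, 2, vK, vTot, aWeight, aAgent, aBase} \<Longrightarrow> nmem t a = nmem s a"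
    and "rmem t 0 = rmem s 0"
  shows "ready as t"
  using assms(1,3) assms(2)[of 0] assms(2)[of 1] assms(2)[of 2] assms(2)[of vK] assms(2)[of vTot]
    assms(2)[of aWeight] assms(2)[of aAgent] assms(2)[of aBase]
  by (simp add: ready_def input_ok_def weights_ok_def)

lemma ready_frame:
  assumes "frame X s t" "ready as s" "X \<inter> {0, 1, 2, vK, vTot, aWeight, aAgent, aBase} = {}"
  shows "ready as t"
  using assms by (intro ready_cong[OF assms(2)]) (auto simp: frame_def)

text \<open>Of the two bounds on \<open>length as\<close>, the one by \<open>m\<close> limits the
  cost of \<open>decode\<close> and the one by \<open>n\<close> the number of codes. They come from
  the length of the policy and from agent 1 having no digit.\<close>

lemma readyD:
  assumes "ready as s"
  shows "nmem s 0 0 = m" "t < m \<Longrightarrow> nmem s 1 t = pol ! t"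
    "i \<in> {1..n} \<Longrightarrow> q < m \<Longrightarrow> nmem s 2 (nmem s aBase i + q) = rank i ! q"
    "g \<in> {1..m} \<Longrightarrow> rmem s 0 g = u g"
    "distinct as" "nmem s vK 0 = length as" "nmem s vTot 0 = Suc m ^ Suc (length as)"
    "j < length as \<Longrightarrow> nmem s aAgent j = as ! j"
    "j < length as \<Longrightarrow> nmem s aWeight (as ! j) = Suc m ^ Suc j"
    "set as = set pol - {1}" "a \<in> set as \<Longrightarrow> a \<in> {1..n}" "length as \<le> m" "length as < n"
proof -
  show *: "distinct as" "set as = set pol - {1}"
    using assms by (auto simp: ready_def weights_ok_def)
  then show "a \<in> set as \<Longrightarrow> a \<in> {1..n}" using pol_agent[of a] by auto
  have "length as = card (set as)" using * distinct_card by metis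
  moreover have "card (set as) \<le> card (set pol)" using * by (intro card_mono) auto
  ultimately show "length as \<le> m" using card_length[of pol] length_pol by simp
  have "card (set as) \<le> card {2..n}" using * pol_agent
    by (intro card_mono) (fastforce simp: Suc_le_eq)+
  then show "length as < n" using \<open>length as = card (set as)\<close> one_le_agents by simp
qed (use assms in \<open>auto simp: ready_def input_ok_def weights_ok_def\<close>)

text \<open>Items outside \<open>D\<close> carry older stamps, which are strictly smaller; so a
  single comparison decides membership, and no item is counted twice.\<close>

definition marks :: "state \<Rightarrow> nat set \<Rightarrow> bool" where
  "marks s D \<longleftrightarrow> finite D \<and> nmem s vCnt 0 = card D \<and>
     (\<forall>x. if x \<in> D then nmem s aMark x = nmem s vTot 0 - nmem s vCode 0
          else nmem s aMark x < nmem s vTot 0 - nmem s vCode 0)"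

text \<open>\<open>vRem\<close> holds the digit \<open>p\<close> above a remainder smaller than the
  weight, so exactly \<open>p\<close> subtractions succeed. \<open>D\<close> is what the agents
  decoded before have touched.\<close>

lemma wp_scan:
  assumes rdy: "ready as s" and J: "J < length as" and vA: "nmem s vA 0 = as ! J" and "nmem s vQ 0 = 0"
    and "nmem s vRem 0 = r + Suc m ^ Suc J * p" and r: "r < Suc m ^ Suc J" and p: "p \<le> m"
    and "marks s D"
    and post: "\<And>t l. nmem t vRem 0 = r \<Longrightarrow> nmem t vQ 0 = p \<Longrightarrow> marks t (D \<union> set (take p (rank (as ! J)))) \<Longrightarrow>
      frame {vRem, vX, aMark, vCnt, vQ} s t \<Longrightarrow> l \<le> k + 80 * (m + 1) \<Longrightarrow> Q t l"
  shows "wp scan s k Q"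
  unfolding scan_def
proof (rule wp_While[where T = 60 and \<mu> = "\<lambda>t. p - nmem t vQ 0" and
      Inv = "\<lambda>t. nmem t vQ 0 \<le> p \<and> nmem t vRem 0 = r + Suc m ^ Suc J * (p - nmem t vQ 0) \<and>
        marks t (D \<union> set (take (nmem t vQ 0) (rank (as ! J)))) \<and>
        frame {vRem, vX, aMark, vCnt, vQ} s t"], goal_cases)
  case 1
  show ?case using assms by (simp add: frame_def)
next
  case (2 t l)
  define q where "q = nmem t vQ 0"
  define D' where "D' = D \<union> set (take q (rank (as ! J)))"
  define x where "x = rank (as ! J) ! q"
  have fr: "frame {vRem, vX, aMark, vCnt, vQ} s t" using 2 by simp
  then have rdy': "ready as t" using rdy by (rule ready_frame) simp
  have a: "nmem t vA 0 = as ! J" using fr vA by (simp add: frame_def)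
  have w: "nmem t aWeight (as ! J) = Suc m ^ Suc J" using readyD(9)[OF rdy' J] .
  have "q < p"
  proof (rule ccontr)
    assume "\<not> q < p"
    with 2 r a w show False by (simp add: q_def)
  qed
  have ag: "as ! J \<in> {1..n}" using readyD(11)[OF rdy] J by simp
  have x: "nmem t 2 (nmem t aBase (as ! J) + q) = x"
    using readyD(3)[OF rdy' ag] \<open>q < p\<close> p by (simp add: x_def)
  have D': "marks t D'" using 2 by (simp add: D'_def q_def)
  have "take (Suc q) (rank (as ! J)) = take q (rank (as ! J)) @ [x]"
    using \<open>q < p\<close> p length_rank[OF ag] by (simp add: x_def take_Suc_conv_app_nth)
  then have ins: "D \<union> set (take (Suc q) (rank (as ! J))) = insert x D'"
    by (auto simp: D'_def)
  have rem: "nmem t vRem 0 - Suc m ^ Suc J = r + Suc m ^ Suc J * (p - Suc q)"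
  proof -
    obtain d where "p = Suc (q + d)" using \<open>q < p\<close> less_iff_Suc_add by auto
    with 2 show ?thesis by (simp add: q_def[symmetric] del: power_Suc)
  qed
  show ?case
    using 2 D' \<open>q < p\<close> fr x a w rem ins
    by (auto simp: wp_simps q_def[symmetric] marks_def frame_def card_insert_if simp del: power_Suc
        split: if_splits)
next
  case (3 t l)
  have fr: "frame {vRem, vX, aMark, vCnt, vQ} s t" using 3 by simp
  then have rdy': "ready as t" using rdy by (rule ready_frame) simp
  have a: "nmem t vA 0 = as ! J" using fr vA by (simp add: frame_def)
  have w: "nmem t aWeight (as ! J) = Suc m ^ Suc J" using readyD(9)[OF rdy' J] .
  have q: "nmem t vQ 0 = p"
  proof (rule ccontr)
    assume "nmem t vQ 0 \<noteq> p"
    then obtain d where "p - nmem t vQ 0 = Suc d" using 3 by (cases "p - nmem t vQ 0") auto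
    with 3 a w show False by (simp del: power_Suc)
  qed
  show ?case
  proof (rule post)
    show "l \<le> k + 80 * (m + 1)" using 3 p assms(4) by simp
  qed (use 3 q in simp_all)
qed

lemma wp_decode:
  assumes rdy: "ready as s" and bd: "bounded as \<tau> p" and "nmem s vCode 0 = enc as \<tau> p"
    and "\<And>x. nmem s aMark x < nmem s vTot 0 - nmem s vCode 0"
    and post: "\<And>t l. nmem t vRem 0 = \<tau> \<Longrightarrow> marks t (touched p) \<Longrightarrow>
      (\<forall>a \<in> set as. nmem t aPtr a = p a) \<Longrightarrow>
      frame {vRem, vCnt, vJ, vA, vQ, vX, aMark, aPtr} s t \<Longrightarrow> l \<le> k + 200 * (m + 1) ^ 2 \<Longrightarrow> Q t l"
  shows "wp decode s k Q"
  unfolding decode_def wp_simps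
proof (rule wp_While[where T = "80 * (m + 1) + 50" and \<mu> = "\<lambda>t. nmem t vJ 0" and
      Inv = "\<lambda>t. nmem t vJ 0 \<le> length as \<and>
        nmem t vRem 0 = \<tau> + Suc m * horner p (take (nmem t vJ 0) as) \<and>
        marks t (\<Union>i \<in> set (drop (nmem t vJ 0) as). set (take (p i) (rank i))) \<and>
        (\<forall>i \<in> set (drop (nmem t vJ 0) as). nmem t aPtr i = p i) \<and>
        frame {vRem, vCnt, vJ, vA, vQ, vX, aMark, aPtr} s t"], goal_cases)
  case 1
  show ?case using assms readyD(6)[OF rdy] by (simp add: frame_def marks_def enc_def)
next
  case (2 t l)
  have fr: "frame {vRem, vCnt, vJ, vA, vQ, vX, aMark, aPtr} s t" using 2 by simp
  then have rdy': "ready as t" using rdy by (rule ready_frame) simp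
  from 2 obtain J where vJ: "nmem t vJ 0 = Suc J" by (cases "nmem t vJ 0") auto
  then have J: "J < length as" using 2 by simp
  define a where "a = as ! J"
  have take: "take (Suc J) as = take J as @ [a]" and drop: "drop J as = a # drop (Suc J) as"
    using J by (simp_all add: a_def take_Suc_conv_app_nth Cons_nth_drop_Suc)
  have ag: "nmem t aAgent J = a" using readyD(8)[OF rdy' J] by (simp add: a_def)
  have rem: "nmem t vRem 0 = \<tau> + Suc m * horner p (take J as) + Suc m ^ Suc J * p a"
    using 2 vJ J by (simp add: take horner_snoc algebra_simps)
  have "Suc (horner p (take J as)) \<le> Suc m ^ J"
    using horner_less[of p "take J as"] bd J by (simp add: bounded_def)
  \<comment> \<open>All lower digits together stay below the weight, so \<open>scan\<close> reads
    exactly \<open>p a\<close>.\<close>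
  from mult_le_mono2[OF this, of "Suc m"] have r: "\<tau> + Suc m * horner p (take J as) < Suc m ^ Suc J"
    using bd by (simp add: bounded_def)
  have mk: "marks t (\<Union>i \<in> set (drop (Suc J) as). set (take (p i) (rank i)))"
    using 2 vJ by simp
  show ?case
    unfolding wp_simps
  proof (rule wp_scan[where as = as and J = J and p = "p a" and r = "\<tau> + Suc m * horner p (take J as)"
        and D = "\<Union>i \<in> set (drop (Suc J) as). set (take (p i) (rank i))"], goal_cases)
    case 1
    show ?case using rdy' by (rule ready_cong) auto
  next
    case (9 t' l')
    have "nmem t' vA 0 = a" "nmem t' vJ 0 = J" "nmem t' aPtr = nmem t aPtr" "rmem t' = rmem t"
      using 9 vJ ag by (auto simp: frame_def)
    moreover have "marks (nwrite aPtr a (p a) t') (\<Union>i \<in> set (drop J as). set (take (p i) (rank i)))"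
      using 9 by (simp add: marks_def drop a_def Un_commute)
    moreover have "frame {vRem, vCnt, vJ, vA, vQ, vX, aMark, aPtr} s (nwrite aPtr a (p a) t')"
      using 9 fr by (simp add: frame_def)
    ultimately show ?case using 9 2 J vJ by (auto simp: drop)
  qed (use J ag vJ rem r bd mk in \<open>auto simp: a_def marks_def bounded_def\<close>)
next
  case (3 t l)
  have "touched p = (\<Union>i \<in> set as. set (take (p i) (rank i)))"
    by (simp add: touched_def readyD(10)[OF rdy])
  moreover have "l \<le> k + 200 * (m + 1) ^ 2"
  proof -
    \<comment> \<open>Here it matters that \<open>as\<close> lists agents of the policy only: the
      cost is quadratic in \<open>m\<close>, however large \<open>n\<close> is.\<close>
    have "length as * (80 * (m + 1) + 60) \<le> m * (80 * (m + 1) + 60)"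
      using readyD(12)[OF rdy] by (rule mult_le_mono1)
    moreover have "l \<le> k + (length as * (80 * (m + 1) + 60) + 100)"
      using 3 readyD(6)[OF rdy] by (simp add: algebra_simps)
    ultimately have "l \<le> k + (m * (80 * (m + 1) + 60) + 100)" by linarith
    then show ?thesis by (simp add: power2_eq_square algebra_simps)
  qed
  ultimately show ?case using 3 by (intro post) auto
qed

section \<open>The table of optimal moves\<close>

text \<open>The strict increase of codes along successors keeps 0 free as the sign of the end and
  bounds the length of \<open>walk\<close>. Kind 0 demands item 0 so that \<open>walk\<close> flags
  no real item.\<close>

definition entry :: "nat list \<Rightarrow> state \<Rightarrow> nat \<Rightarrow> (nat \<Rightarrow> nat) \<Rightarrow> bool" where
  "entry as s t p \<longleftrightarrow>
     rmem s 1 (enc as t p) = cost (snd (opt t p)) \<and>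
     (nmem s aNext (enc as t p) = 0 \<and> opt t p = ([], []) \<or>
      (\<exists>t' p'. bounded as t' p' \<and> nmem s aNext (enc as t p) = enc as t' p' \<and>
         enc as t p < enc as t' p' \<and>
         (nmem s aAct (enc as t p) = 0 \<and> nmem s aItem (enc as t p) = 0 \<and> opt t p = opt t' p' \<or>
          nmem s aAct (enc as t p) = 1 \<and>
            opt t p = apfst ((#) (nmem s aItem (enc as t p))) (opt t' p') \<or>
          nmem s aAct (enc as t p) = 2 \<and>
            opt t p = apsnd ((#) (nmem s aItem (enc as t p))) (opt t' p'))))"

lemma entryI:
  assumes "rmem s 1 (enc as t p) = cost (snd (opt t p))" "bounded as t' p'"
    and "nmem s aNext (enc as t p) = enc as t' p'" "enc as t p < enc as t' p'"
    and "nmem s aAct (enc as t p) = 0 \<and> nmem s aItem (enc as t p) = 0 \<and> opt t p = opt t' p' \<or>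
      nmem s aAct (enc as t p) = 1 \<and> opt t p = apfst ((#) (nmem s aItem (enc as t p))) (opt t' p') \<or>
      nmem s aAct (enc as t p) = 2 \<and> opt t p = apsnd ((#) (nmem s aItem (enc as t p))) (opt t' p')"
  shows "entry as s t p"
  using assms unfolding entry_def by blast

definition same_at :: "nat \<Rightarrow> state \<Rightarrow> state \<Rightarrow> bool" where
  "same_at c s t \<longleftrightarrow> rmem t 1 c = rmem s 1 c \<and> nmem t aNext c = nmem s aNext c \<and>
     nmem t aAct c = nmem s aAct c \<and> nmem t aItem c = nmem s aItem c"

definition empty_at :: "nat \<Rightarrow> state \<Rightarrow> bool" where
  "empty_at c s \<longleftrightarrow> rmem s 1 c = 0 \<and> nmem s aNext c = 0 \<and> nmem s aAct c = 0 \<and> nmem s aItem c = 0"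

text \<open>Cells below \<open>c\<close> must still be zero because \<open>decide\<close> leaves
  default values unwritten.\<close>

definition table_ok :: "nat list \<Rightarrow> nat \<Rightarrow> state \<Rightarrow> bool" where
  "table_ok as c s \<longleftrightarrow> (\<forall>t p. bounded as t p \<longrightarrow> c \<le> enc as t p \<longrightarrow> entry as s t p) \<and>
     (\<forall>c' < c. empty_at c' s)"

lemma entry_cong: "same_at (enc as t p) s s' \<Longrightarrow> entry as s t p \<Longrightarrow> entry as s' t p"
  by (simp add: entry_def same_at_def)

text \<open>By \<open>enc_inj\<close> a code belongs to a single bounded state, so writing there
  leaves the entries of all other states intact.\<close>

lemma table_ok_step:
  assumes "table_ok as (Suc (enc as t p)) s" "bounded as t p"
    and "entry as s' t p" "\<And>c. c \<noteq> enc as t p \<Longrightarrow> same_at c s s'"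
  shows "table_ok as (enc as t p) s'"
  unfolding table_ok_def
proof (intro conjI allI impI)
  fix t' p' assume *: "bounded as t' p'" "enc as t p \<le> enc as t' p'"
  show "entry as s' t' p'"
  proof (cases "enc as t' p' = enc as t p")
    case True
    with enc_inj[OF *(1) assms(2)] assms(3) show ?thesis by simp
  next
    case False
    with * assms(1) have "entry as s t' p'" by (simp add: table_ok_def)
    with assms(4)[OF False] show ?thesis by (rule entry_cong)
  qed
next
  fix c' assume "c' < enc as t p"
  with assms(1) assms(4)[of c'] show "empty_at c' s'"
    by (simp add: table_ok_def empty_at_def same_at_def)
qed

text \<open>\<open>decide\<close> writes costs to real array 1, so, unlike in \<open>frame\<close>,
  only the utilities in real array 0 are kept.\<close>

definition nat_frame :: "nat set \<Rightarrow> state \<Rightarrow> state \<Rightarrow> bool" where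
  "nat_frame X s t \<longleftrightarrow> rmem t 0 = rmem s 0 \<and> (\<forall>a. a \<notin> X \<longrightarrow> nmem t a = nmem s a)"

lemma enc_bump:
  assumes "distinct as" "j < length as" "pol ! t = as ! j"
  shows "enc as t' (bump t p) = enc as t' p + Suc m ^ Suc j"
  using horner_bump[OF assms(1,2), of p] assms(3) by (simp add: enc_def bump_def algebra_simps)

lemma wp_decide:
  assumes rdy: "ready as s" and bd: "bounded as \<tau> p" and code: "nmem s vCode 0 = enc as \<tau> p"
    and rem: "nmem s vRem 0 = \<tau>" and mk: "marks s (touched p)"
    and ptr: "\<forall>a \<in> set as. nmem s aPtr a = p a" and tab: "table_ok as (Suc (enc as \<tau> p)) s"
  shows "wp decide s k (\<lambda>t l. table_ok as (enc as \<tau> p) t \<and>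
    nat_frame {vA, vQ, vX, vC', aNext, aAct, aItem} s t \<and> l \<le> k + 150)"
proof -
  define c where "c = enc as \<tau> p"
  have empty: "rmem s 1 c = 0" "nmem s aNext c = 0" "nmem s aAct c = 0" "nmem s aItem c = 0"
    using tab by (auto simp: table_ok_def empty_at_def c_def)
  have val: "rmem s 1 (enc as t' p') = cost (snd (opt t' p'))"
    if "bounded as t' p'" "c < enc as t' p'" for t' p'
    using tab that by (auto simp: table_ok_def entry_def c_def)
  have M: "nmem s 0 0 = m" using readyD(1)[OF rdy] .
  have step: "table_ok as c s'" if "entry as s' \<tau> p" "\<And>c'. c' \<noteq> c \<Longrightarrow> same_at c' s s'" for s'
    using table_ok_step[OF tab bd that(1)] that(2) by (simp add: c_def)
  \<comment> \<open>An unwritten entry already represents \<open>([], [])\<close>, whose cost is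
    0.\<close>
  have idle: "table_ok as c s" if "opt \<tau> p = ([], [])"
    using that empty by (intro step) (auto simp: entry_def same_at_def c_def)
  show ?thesis
  proof (cases "\<tau> < m")
    case False
    then have "opt \<tau> p = ([], [])" by (subst opt_unfold) simp
    from idle[OF this] show ?thesis
      using False by (simp add: decide_def wp_simps rem M nat_frame_def c_def)
  next
    case \<tau>: True
    define a where "a = pol ! \<tau>"
    have a: "nmem s 1 \<tau> = a" using readyD(2)[OF rdy \<tau>] by (simp add: a_def)
    have ag: "a \<in> {1..n}" using pol_nth_agent[OF \<tau>] by (simp add: a_def)
    show ?thesis
    proof (cases "a = 1")
      case True
      have o: "opt \<tau> p = opt (Suc \<tau>) p"
        using \<tau> True by (subst opt_unfold) (simp add: a_def)
      have bd': "bounded as (Suc \<tau>) p" and e: "enc as (Suc \<tau>) p = Suc c"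
        using bd \<tau> by (auto simp: bounded_def enc_def c_def)
      have v: "rmem s 1 (Suc c) = cost (snd (opt \<tau> p))"
        using val[OF bd'] e o by simp
      define s' where "s' = nwrite aNext c (Suc c) (rwrite 1 c (rmem s 1 (Suc c)) (nwrite vA 0 1 s))"
      have "entry as s' \<tau> p"
        by (rule entryI[where t' = "Suc \<tau>" and p' = "p"], unfold c_def[symmetric])
          (use bd' e v o empty in \<open>auto simp: s'_def\<close>)
      then have "table_ok as c s'"
        by (rule step) (simp add: same_at_def s'_def)
      then show ?thesis
        using True \<tau> a
        by (simp add: decide_def wp_simps rem M code nat_frame_def c_def[symmetric] s'_def)
    next
      case a1: False
      have "a \<in> set as" using a1 \<tau> readyD(10)[OF rdy] by (simp add: a_def length_pol)
      then obtain j where j: "j < length as" "as ! j = a" by (auto simp: in_set_conv_nth)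
      have q: "nmem s aPtr a = p a" using ptr \<open>a \<in> set as\<close> by simp
      have w: "nmem s aWeight a = Suc m ^ Suc j" using readyD(9)[OF rdy j(1)] j by simp
      have a2: "\<not> a < 2" using a1 ag by auto
      show ?thesis
      proof (cases "p a < m")
        case False
        then have "opt \<tau> p = ([], [])"
          using a1 \<tau> by (subst opt_unfold) (simp add: a_def)
        from step[of "nwrite vQ 0 (p a) (nwrite vA 0 a s)"] idle[OF this] this
        have "table_ok as c (nwrite vQ 0 (p a) (nwrite vA 0 a s))"
          using empty by (simp add: entry_def same_at_def c_def)
        then show ?thesis
          using False a2 \<tau> a q by (simp add: decide_def wp_simps rem M nat_frame_def c_def)
      next
        case pa: True
        define x where "x = the_item \<tau> p"
        define c' where "c' = c + Suc m ^ Suc j"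
        have x: "nmem s 2 (nmem s aBase a + p a) = x"
          using readyD(3)[OF rdy ag pa] by (simp add: x_def the_item_def a_def)
        have "x \<in> {1..m}" using the_item_mem \<tau> pa by (simp add: x_def a_def)
        then have ux: "rmem s 0 x = u x" by (rule readyD(4)[OF rdy])
        have e1: "enc as \<tau> (bump \<tau> p) = c'" and e2: "enc as (Suc \<tau>) (bump \<tau> p) = Suc c'"
          using enc_bump[OF readyD(5)[OF rdy] j(1)] j(2)
          by (simp_all add: a_def c'_def c_def enc_def)
        have b1: "bounded as \<tau> (bump \<tau> p)" and b2: "bounded as (Suc \<tau>) (bump \<tau> p)"
          using bd pa \<tau> \<open>a \<in> set as\<close> by (auto simp: bounded_def bump_def a_def)
        have "c < c'" by (simp add: c'_def)
        have v1: "rmem s 1 c' = cost (snd (opt \<tau> (bump \<tau> p)))"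
          and v2: "rmem s 1 (Suc c') = cost (snd (opt (Suc \<tau>) (bump \<tau> p)))"
          using val[OF b1] val[OF b2] e1 e2 \<open>c < c'\<close> by simp_all
        have marked: "nmem s aMark x < nmem s vTot 0 - c \<longleftrightarrow> x \<notin> touched p"
          using mk code by (auto simp: marks_def c_def split: if_splits)
        have cnt: "nmem s vCnt 0 = card (touched p)" using mk by (simp add: marks_def)
        define s0 where "s0 = nwrite vC' 0 c' (nwrite vX 0 x (nwrite vQ 0 (p a) (nwrite vA 0 a s)))"
        show ?thesis
        proof (cases "x \<in> touched p")
          case True
          have o: "opt \<tau> p = opt \<tau> (bump \<tau> p)"
            using \<tau> a1 pa True by (subst opt_unfold) (simp add: a_def x_def)
          define s' where "s' = nwrite aNext c c' (rwrite 1 c (rmem s 1 c') s0)"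
          have "entry as s' \<tau> p"
            by (rule entryI[where t' = "\<tau>" and p' = "bump \<tau> p"], unfold c_def[symmetric])
              (use b1 e1 v1 o empty \<open>c < c'\<close> in \<open>auto simp: s'_def s0_def\<close>)
          then have "table_ok as c s'"
            by (rule step) (simp add: same_at_def s'_def s0_def)
          then show ?thesis
            using True \<tau> a a2 q x pa w marked
            by (simp add: decide_def wp_simps rem M code nat_frame_def c_def[symmetric] c'_def[symmetric]
                s'_def s0_def del: power_Suc)
        next
          case nt: False
          show ?thesis
          proof (cases "leaves \<tau> p")
            case True
            have o: "opt \<tau> p = apfst ((#) x) (opt \<tau> (bump \<tau> p))"
              using \<tau> a1 pa nt True by (subst opt_unfold) (simp add: a_def x_def)
            define s' where
              "s' = nwrite aAct c 1 (nwrite aNext c c' (rwrite 1 c (rmem s 1 c') (nwrite aItem c x s0)))"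
            have "entry as s' \<tau> p"
              by (rule entryI[where t' = "\<tau>" and p' = "bump \<tau> p"], unfold c_def[symmetric])
                (use b1 e1 v1 o \<open>c < c'\<close> in \<open>auto simp: s'_def s0_def\<close>)
            then have "table_ok as c s'"
              by (rule step) (simp add: same_at_def s'_def s0_def)
            moreover have "nmem s vCnt 0 < \<tau>" "rmem s 1 c' < rmem s 0 x + rmem s 1 (Suc c')"
              using True unfolding leaves_def cnt v1 v2 ux x_def[symmetric] by simp_all
            ultimately show ?thesis
              using nt \<tau> a a2 q x pa w marked
              by (simp add: decide_def wp_simps rem M code nat_frame_def c_def[symmetric] c'_def[symmetric]
                  s'_def s0_def del: power_Suc)
          next
            case False
            have o: "opt \<tau> p = apsnd ((#) x) (opt (Suc \<tau>) (bump \<tau> p))"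
              using \<tau> a1 pa nt False by (subst opt_unfold) (simp add: a_def x_def)
            define s' where
              "s' = nwrite aAct c 2 (nwrite aNext c (Suc c')
                (rwrite 1 c (rmem s 0 x + rmem s 1 (Suc c')) (nwrite aItem c x s0)))"
            have "entry as s' \<tau> p"
              by (rule entryI[where t' = "Suc \<tau>" and p' = "bump \<tau> p"], unfold c_def[symmetric])
                (use b2 e2 v2 ux o \<open>c < c'\<close> in \<open>auto simp: s'_def s0_def\<close>)
            then have "table_ok as c s'"
              by (rule step) (simp add: same_at_def s'_def s0_def)
            moreover have "\<not> (nmem s vCnt 0 < \<tau> \<and> rmem s 1 c' < rmem s 0 x + rmem s 1 (Suc c'))"
              using False unfolding leaves_def cnt v1 v2 ux x_def[symmetric] by simp
            ultimately show ?thesis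
              using nt \<tau> a a2 q x pa w marked
              by (simp add: decide_def wp_simps rem M code nat_frame_def c_def[symmetric] c'_def[symmetric]
                  s'_def s0_def del: power_Suc) blast
          qed
        qed
      qed
    qed
  qed
qed

lemma wp_table:
  assumes rdy: "ready as s" and "\<And>c. empty_at c s" "nmem s aMark = (\<lambda>_. 0)"
    and post: "\<And>t l. ready as t \<Longrightarrow> table_ok as 0 t \<Longrightarrow> nmem t aFlag = nmem s aFlag \<Longrightarrow>
      l \<le> k + Suc m ^ Suc (length as) * (500 * (m + 1) ^ 2) + 20 \<Longrightarrow> Q t l"
  shows "wp table s k Q"
  unfolding table_def wp_simps
proof (rule wp_While[where T = "200 * (m + 1) ^ 2 + 200" and \<mu> = "\<lambda>t. nmem t vCode 0" and
      Inv = "\<lambda>t. nmem t vCode 0 \<le> Suc m ^ Suc (length as) \<and> ready as t \<and> table_ok as (nmem t vCode 0) t \<and>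
        (\<forall>x. nmem t aMark x \<le> Suc m ^ Suc (length as) - nmem t vCode 0) \<and>
        nmem t aFlag = nmem s aFlag"], goal_cases)
  case 1
  have "ready as (nwrite vCode 0 (nmem s vTot 0) s)"
    using rdy by (rule ready_cong) auto
  \<comment> \<open>Every code of a bounded state is below \<open>vTot\<close>, so no entry is
    demanded yet.\<close>
  moreover have "table_ok as (Suc m ^ Suc (length as)) (nwrite vCode 0 (nmem s vTot 0) s)"
    using assms(2) enc_less by (fastforce simp: table_ok_def empty_at_def)
  ultimately show ?case
    using assms(3) readyD(7)[OF rdy] by simp
next
  case (2 t l)
  then obtain c where c: "nmem t vCode 0 = Suc c" by (cases "nmem t vCode 0") auto
  then have "c < Suc m ^ Suc (length as)" using 2 by simp
  have rdy': "ready as t" using 2 by simp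
  from enc_surj[OF readyD(5)[OF rdy] \<open>c < _\<close>] obtain \<tau> p
    where bd: "bounded as \<tau> p" and e: "enc as \<tau> p = c" .
  have tot: "nmem t vTot 0 = Suc m ^ Suc (length as)" by (rule readyD(7)[OF rdy'])
  show ?case
    unfolding wp_simps
  proof (rule wp_decode[where as = as and \<tau> = \<tau> and p = p], goal_cases)
    case 1
    show ?case using rdy' by (rule ready_cong) auto
  next
    case 2
    show ?case by (rule bd)
  next
    case 3
    show ?case using c e by simp
  next
    \<comment> \<open>Lowering \<open>vCode\<close> by one raises the stamp by one, which makes all
      earlier marks stale.\<close>
    case (4 x)
    show ?case using \<open>c < _\<close> 2 c tot
      by (simp add: le_less_trans[of _ "Suc m ^ Suc (length as) - Suc c"] diff_less_mono2)
  next
    case (5 t1 l1)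
    have code: "nmem t1 vCode 0 = c" and tot1: "nmem t1 vTot 0 = Suc m ^ Suc (length as)"
      and flag: "nmem t1 aFlag = nmem s aFlag"
      using 5 2 c tot by (auto simp: frame_def)
    have "ready as (nwrite vCode 0 c t)" using rdy' by (rule ready_cong) auto
    with 5 c have rdy1: "ready as t1" by (auto intro: ready_frame)
    have "table_ok as (Suc (enc as \<tau> p)) t1"
      using 5 2 c e by (simp add: table_ok_def empty_at_def entry_def frame_def)
    with 5 code e bd rdy1 have "wp decide t1 l1 (\<lambda>t l. table_ok as (enc as \<tau> p) t \<and>
        nat_frame {vA, vQ, vX, vC', aNext, aAct, aItem} t1 t \<and> l \<le> l1 + 150)"
      by (intro wp_decide) auto
    then show ?case
    proof (rule wp_mono, goal_cases)
      case (1 t2 l2)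
      have "ready as t2" using rdy1 by (rule ready_cong) (use 1 in \<open>auto simp: nat_frame_def\<close>)
      moreover have "nmem t1 aMark x \<le> Suc m ^ Suc (length as) - c" for x
        using 5 code tot1 by (auto simp: marks_def split: if_splits dest!: spec[of _ x])
      moreover have "nmem t2 vCode = nmem t1 vCode" "nmem t2 aMark = nmem t1 aMark"
        "nmem t2 aFlag = nmem t1 aFlag"
        using 1 by (auto simp: nat_frame_def)
      ultimately show ?case using 1 5 c e code flag \<open>c < _\<close> by simp
    qed
  qed
next
  case (3 t l)
  have "l \<le> k + Suc m ^ Suc (length as) * (500 * (m + 1) ^ 2) + 20"
  proof -
    \<comment> \<open>The summand 205 is the 200 from \<open>T\<close> plus the charge 5 for the
      loop test.\<close>
    have "200 * (m + 1) ^ 2 + 205 \<le> 500 * (m + 1) ^ 2" by (simp add: power2_eq_square)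
    then have "Suc m ^ Suc (length as) * (200 * (m + 1) ^ 2 + 205) \<le>
        Suc m ^ Suc (length as) * (500 * (m + 1) ^ 2)"
      by (rule mult_le_mono2)
    moreover have "l \<le> k + Suc m ^ Suc (length as) * (200 * (m + 1) ^ 2 + 205) + 20"
      using 3 readyD(7)[OF rdy] by (simp add: add.commute del: power_Suc)
    ultimately show ?thesis by linarith
  qed
  with 3 show ?case by (intro post) auto
qed

section \<open>Reading off the strategy\<close>

definition holds_list :: "state \<Rightarrow> nat list \<Rightarrow> bool" where
  "holds_list s xs \<longleftrightarrow> nmem s vLen 0 = length xs \<and> (\<forall>j < length xs. nmem s aOut j = xs ! j)"

abbreviation "start \<equiv> \<lambda>_ :: nat. 0 :: nat"

definition flags :: "nat list \<Rightarrow> nat list \<Rightarrow> state \<Rightarrow> bool" where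
  "flags xs ys s \<longleftrightarrow>
     (\<forall>x \<ge> 1. nmem s aFlag x = (if x \<in> set xs then 1 else if x \<in> set ys then 2 else 0))"

text \<open>The invariant splits the optimal pair into the part already read and \<open>opt\<close>
  of the current state. Codes increase along the walk, so their number bounds its length, a crude
  bound but of no higher order than the cost of the table.\<close>

lemma wp_walk:
  assumes rdy: "ready as s" and tab: "table_ok as 0 s" and "nmem s aFlag = (\<lambda>_. 0)"
    and post: "\<And>t l. nmem t 0 = nmem s 0 \<Longrightarrow> holds_list t (fst (opt 0 start)) \<Longrightarrow>
      flags (fst (opt 0 start)) (snd (opt 0 start)) t \<Longrightarrow>
      l \<le> k + Suc m ^ Suc (length as) * 100 + 100 \<Longrightarrow> Q t l"
  shows "wp walk s k Q"
  unfolding walk_def wp_simps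
proof (rule wp_While[where T = 80 and \<mu> = "\<lambda>t. Suc m ^ Suc (length as) - nmem t vCode 0" and
      Inv = "\<lambda>t. frame {vCode, vX, aFlag, aOut, vLen} s t \<and>
        (\<exists>\<tau> p xs ys. bounded as \<tau> p \<and> nmem t vCode 0 = enc as \<tau> p \<and>
           opt 0 start = (xs @ fst (opt \<tau> p), ys @ snd (opt \<tau> p)) \<and>
           holds_list t xs \<and> flags xs ys t)"], goal_cases)
  case 1
  \<comment> \<open>The initial state has code 0, which is where the walk starts.\<close>
  have "horner start as = 0" by (induction as) auto
  then show ?case using assms(3)
    by (auto simp: frame_def bounded_def enc_def holds_list_def flags_def
        intro!: exI[of _ 0] exI[of _ start] exI[of _ "[]"])
next
  case (2 t l)
  then obtain \<tau> p xs ys where bd: "bounded as \<tau> p" and code: "nmem t vCode 0 = enc as \<tau> p"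
    and o: "opt 0 start = (xs @ fst (opt \<tau> p), ys @ snd (opt \<tau> p))"
    and out: "holds_list t xs" and fl: "flags xs ys t" by auto
  define c where "c = enc as \<tau> p"
  have fr: "frame {vCode, vX, aFlag, aOut, vLen} s t" using 2 by simp
  have "entry as s \<tau> p" using tab bd by (simp add: table_ok_def)
  then have "entry as t \<tau> p"
    by (rule entry_cong[rotated]) (use fr in \<open>auto simp: same_at_def frame_def\<close>)
  moreover have "0 < nmem t aNext c" using 2 code by (simp add: c_def)
  ultimately obtain \<tau>' p' where bd': "bounded as \<tau>' p'" and nxt: "nmem t aNext c = enc as \<tau>' p'"
    and less: "c < enc as \<tau>' p'"
    and act: "nmem t aAct c = 0 \<and> nmem t aItem c = 0 \<and> opt \<tau> p = opt \<tau>' p' \<or>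
      nmem t aAct c = 1 \<and> opt \<tau> p = apfst ((#) (nmem t aItem c)) (opt \<tau>' p') \<or>
      nmem t aAct c = 2 \<and> opt \<tau> p = apsnd ((#) (nmem t aItem c)) (opt \<tau>' p')"
    by (auto simp: entry_def c_def)
  define x where "x = nmem t aItem c"
  have mono: "Suc m ^ Suc (length as) - enc as \<tau>' p' < Suc m ^ Suc (length as) - c"
    using less enc_less[OF bd'] by (intro diff_less_mono2) auto
  have items: "set (xs @ fst (opt \<tau> p)) \<union> set (ys @ snd (opt \<tau> p)) \<subseteq> {1..m}"
    "distinct ((xs @ fst (opt \<tau> p)) @ (ys @ snd (opt \<tau> p)))"
    using opt_lists[of 0 start] unfolding o by auto
  from act show ?case
  proof (elim disjE conjE)
    assume *: "nmem t aAct c = 0" "nmem t aItem c = 0" "opt \<tau> p = opt \<tau>' p'"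
    define t' where "t' = nwrite vCode 0 (enc as \<tau>' p') (nwrite aFlag 0 0 (nwrite vX 0 0 t))"
    have "frame {vCode, vX, aFlag, aOut, vLen} s t'" "holds_list t' xs" "flags xs ys t'"
      using fr out fl by (auto simp: t'_def frame_def holds_list_def flags_def)
    moreover have "opt 0 start = (xs @ fst (opt \<tau>' p'), ys @ snd (opt \<tau>' p'))"
      using o * by simp
    moreover have "nmem t' vCode 0 = enc as \<tau>' p'" by (simp add: t'_def)
    ultimately have inv: "frame {vCode, vX, aFlag, aOut, vLen} s t' \<and>
        (\<exists>\<tau> p xs ys. bounded as \<tau> p \<and> nmem t' vCode 0 = enc as \<tau> p \<and>
           opt 0 start = (xs @ fst (opt \<tau> p), ys @ snd (opt \<tau> p)) \<and>
           holds_list t' xs \<and> flags xs ys t')" using bd' by blast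
    show ?thesis unfolding wp_simps
      using inv code * nxt mono by (simp add: c_def[symmetric] t'_def del: power_Suc)
  next
    assume *: "nmem t aAct c = 1" "opt \<tau> p = apfst ((#) (nmem t aItem c)) (opt \<tau>' p')"
    define t' where "t' = nwrite vCode 0 (enc as \<tau>' p') (nwrite vLen 0 (Suc (nmem t vLen 0))
      (nwrite aOut (nmem t vLen 0) x (nwrite aFlag x 1 (nwrite vX 0 x t))))"
    have "frame {vCode, vX, aFlag, aOut, vLen} s t'" "holds_list t' (xs @ [x])" "flags (xs @ [x]) ys t'"
      using fr out fl by (auto simp: t'_def frame_def holds_list_def flags_def nth_append less_Suc_eq)
    moreover have "opt 0 start = ((xs @ [x]) @ fst (opt \<tau>' p'), ys @ snd (opt \<tau>' p'))"
      using o * by (simp add: x_def)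
    moreover have "nmem t' vCode 0 = enc as \<tau>' p'" by (simp add: t'_def)
    ultimately have inv: "frame {vCode, vX, aFlag, aOut, vLen} s t' \<and>
        (\<exists>\<tau> p xs ys. bounded as \<tau> p \<and> nmem t' vCode 0 = enc as \<tau> p \<and>
           opt 0 start = (xs @ fst (opt \<tau> p), ys @ snd (opt \<tau> p)) \<and>
           holds_list t' xs \<and> flags xs ys t')" using bd' by blast
    show ?thesis unfolding wp_simps
      using inv code * nxt mono by (simp add: c_def[symmetric] t'_def x_def[symmetric] del: power_Suc)
  next
    assume *: "nmem t aAct c = 2" "opt \<tau> p = apsnd ((#) (nmem t aItem c)) (opt \<tau>' p')"
    \<comment> \<open>Membership in \<open>xs\<close> takes precedence in \<open>flags\<close>, so
      flag 2 is right only because the two lists of \<open>opt\<close> are disjoint.\<close>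
    have x: "x \<notin> set xs" using items(2) * by (auto simp: x_def)
    define t' where "t' = nwrite vCode 0 (enc as \<tau>' p') (nwrite aFlag x 2 (nwrite vX 0 x t))"
    have "frame {vCode, vX, aFlag, aOut, vLen} s t'" "holds_list t' xs" "flags xs (ys @ [x]) t'"
      using fr out fl x by (auto simp: t'_def frame_def holds_list_def flags_def)
    moreover have "opt 0 start = (xs @ fst (opt \<tau>' p'), (ys @ [x]) @ snd (opt \<tau>' p'))"
      using o * by (simp add: x_def)
    moreover have "nmem t' vCode 0 = enc as \<tau>' p'" by (simp add: t'_def)
    ultimately have inv: "frame {vCode, vX, aFlag, aOut, vLen} s t' \<and>
        (\<exists>\<tau> p xs ys. bounded as \<tau> p \<and> nmem t' vCode 0 = enc as \<tau> p \<and>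
           opt 0 start = (xs @ fst (opt \<tau> p), ys @ snd (opt \<tau> p)) \<and>
           holds_list t' xs \<and> flags xs ys t')" using bd' by blast
    show ?thesis unfolding wp_simps
      using inv code * nxt mono by (simp add: c_def[symmetric] t'_def x_def[symmetric] del: power_Suc)
  qed
next
  case (3 t l)
  then obtain \<tau> p xs ys where bd: "bounded as \<tau> p" and code: "nmem t vCode 0 = enc as \<tau> p"
    and o: "opt 0 start = (xs @ fst (opt \<tau> p), ys @ snd (opt \<tau> p))"
    and out: "holds_list t xs" and fl: "flags xs ys t" by auto
  have fr: "frame {vCode, vX, aFlag, aOut, vLen} s t" using 3 by simp
  have "entry as s \<tau> p" using tab bd by (simp add: table_ok_def)
  then have "entry as t \<tau> p"
    by (rule entry_cong[rotated]) (use fr in \<open>auto simp: same_at_def frame_def\<close>)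
  moreover have "nmem t aNext (enc as \<tau> p) = 0" using 3 code by simp
  ultimately have "opt \<tau> p = ([], [])" by (auto simp: entry_def)
  with o have "opt 0 start = (xs, ys)" by simp
  moreover have "l \<le> k + Suc m ^ Suc (length as) * 100 + 100"
    using 3 by (simp del: power_Suc)
  moreover have "nmem t 0 = nmem s 0" using fr by (simp add: frame_def)
  ultimately show ?case using out fl by (intro post) auto
qed

lemma wp_append_flagged:
  assumes "nmem s 0 0 = m" "holds_list s xs"
    and post: "\<And>t l. frame {vI, aOut, vLen} s t \<Longrightarrow>
      holds_list t (xs @ filter (\<lambda>x. nmem s aFlag x = f) [1..<Suc m]) \<Longrightarrow>
      l \<le> k + 100 * (m + 1) \<Longrightarrow> Q t l"
  shows "wp (append_flagged f) s k Q"
  unfolding append_flagged_def wp_simps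
proof (rule wp_While[where T = 60 and \<mu> = "\<lambda>t. Suc m - nmem t vI 0" and
      Inv = "\<lambda>t. 1 \<le> nmem t vI 0 \<and> nmem t vI 0 \<le> Suc m \<and> frame {vI, aOut, vLen} s t \<and>
        holds_list t (xs @ filter (\<lambda>x. nmem s aFlag x = f) [1..<nmem t vI 0])"], goal_cases)
  case 1
  show ?case using assms(2) by (auto simp: frame_def holds_list_def)
next
  case (2 t l)
  define i where "i = nmem t vI 0"
  have m: "nmem t 0 0 = m" "nmem t aFlag = nmem s aFlag" using 2 assms(1) by (auto simp: frame_def)
  have i: "1 \<le> i" "i < Suc m" using 2 m by (auto simp: i_def)
  define ys where "ys = xs @ filter (\<lambda>x. nmem s aFlag x = f) [1..<i]"
  have ys: "xs @ filter (\<lambda>x. nmem s aFlag x = f) [1..<Suc i] =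
      (if nmem s aFlag i = f then ys @ [i] else ys)"
    using i by (simp add: ys_def)
  have out: "holds_list t ys" and fr: "frame {vI, aOut, vLen} s t"
    using 2 by (auto simp: ys_def i_def)
  show ?case
  proof (cases "nmem s aFlag i = f")
    case True
    define t' where "t' = nwrite vI 0 (Suc i) (nwrite vLen 0 (Suc (nmem t vLen 0))
      (nwrite aOut (nmem t vLen 0) i t))"
    have "holds_list t' (ys @ [i])" "frame {vI, aOut, vLen} s t'"
      using out fr by (auto simp: t'_def holds_list_def frame_def nth_append less_Suc_eq)
    then show ?thesis
      unfolding wp_simps using True m i ys
      by (simp add: i_def[symmetric] t'_def diff_less_mono2 del: upt_Suc)
  next
    case False
    define t' where "t' = nwrite vI 0 (Suc i) t"
    have "holds_list t' ys" "frame {vI, aOut, vLen} s t'"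
      using out fr by (auto simp: t'_def holds_list_def frame_def)
    moreover have "nmem s aFlag i < f \<or> f < nmem s aFlag i" using False by auto
    ultimately show ?thesis
      unfolding wp_simps using False m i ys
      by (auto simp: i_def[symmetric] t'_def diff_less_mono2 wp_simps simp del: upt_Suc)
  qed
next
  case (3 t l)
  then have "nmem t 0 0 = m" using assms(1) by (auto simp: frame_def)
  with 3 have "nmem t vI 0 = Suc m" by auto
  with 3 show ?case by (intro post) (auto simp del: upt_Suc)
qed

section \<open>Assembling the program and its time bound\<close>

lemma input_ok_initial_state: "input_ok (initial_state I)"
proof -
  have "nmem (initial_state I) 2 ((i - 1) * m + q) = rank i ! q" if "i \<in> {1..n}" "q < m" for i q
  proof -
    have "(i - 1) * m + q < (i - 1) * m + m" using that by simp
    also have "\<dots> = i * m" using that by (cases i) auto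
    also have "\<dots> \<le> n * m" using that by simp
    finally show ?thesis using that by (simp add: initial_state_def Let_def)
  qed
  then show ?thesis
    by (auto simp: input_ok_def initial_state_def Let_def items_def)
qed

lemma initial_state_zero:
  "3 \<le> a \<Longrightarrow> nmem (initial_state I) a = (\<lambda>_. 0)" "rmem (initial_state I) 1 = (\<lambda>_. 0)"
  by (auto simp: initial_state_def Let_def fun_eq_iff)

lemma input_ok_frame:
  assumes "frame X s t" "input_ok s" "X \<inter> {0, 1, 2} = {}"
  shows "input_ok t"
proof -
  have "nmem t 0 = nmem s 0" "nmem t 1 = nmem s 1" "nmem t 2 = nmem s 2" "rmem t = rmem s"
    using assms(1,3) by (auto simp: frame_def)
  with assms(2) show ?thesis by (simp add: input_ok_def)
qed

text \<open>The items with flag 0 serve as \<open>U\<close> and those with flag 2 as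
  \<open>N\<close> in \<open>best_response_opt\<close>.\<close>

lemma best_response_flags:
  assumes "flags (fst (opt 0 start)) (snd (opt 0 start)) s"
  shows "best_response I (fst (opt 0 start) @ filter (\<lambda>x. nmem s aFlag x = 0) [1..<Suc m] @
    filter (\<lambda>x. nmem s aFlag x = 2) [1..<Suc m])" (is "best_response I ?\<sigma>")
proof -
  obtain xs ys where o: "opt 0 start = (xs, ys)" by fastforce
  have items: "set xs \<union> set ys \<subseteq> {1..m}" "distinct (xs @ ys)"
    using opt_lists[of 0 start] by (auto simp: o)
  have "nmem s aFlag x = 2 \<longleftrightarrow> x \<in> set ys" "nmem s aFlag x = 0 \<longleftrightarrow> x \<notin> set xs \<union> set ys"
    if "x \<in> set [1..<Suc m]" for x
    using assms items(2) that by (auto simp: flags_def o simp del: upt_Suc)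
  then have N: "set (filter (\<lambda>x. nmem s aFlag x = 2) [1..<Suc m]) = {1..m} \<inter> set ys"
    and U: "set (filter (\<lambda>x. nmem s aFlag x = 0) [1..<Suc m]) = {1..m} - set xs - set ys"
    by (auto simp del: upt_Suc)
  show ?thesis
  proof (rule best_response_opt[OF refl])
    show "distinct ?\<sigma>"
      unfolding distinct_append set_append N U o using items
      by (auto simp del: upt_Suc)
    show "set ?\<sigma> = {1..m}"
      unfolding set_append N U o using items by auto
    show "set (filter (\<lambda>x. nmem s aFlag x = 2) [1..<Suc m]) = set (snd (opt 0 start))"
      unfolding N o using items by auto
  qed
qed

text \<open>\<open>K\<close> stands for the number of agents with a digit; \<open>K < n\<close>
  keeps the table within exponent \<open>n + 2\<close>. The term linear in \<open>n\<close> is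
  absorbed by \<open>n < 2 ^ n \<le> (m + 1) ^ n\<close>, which needs \<open>0 < m\<close>. The
  coefficients add up to 1270, rounded up to 2000.\<close>

lemma time_bound:
  assumes "0 < m" "K < n"
    and "l \<le> 50 * (n + 1) + 200 * (m + 1) ^ 2 + (Suc m ^ Suc K * (500 * (m + 1) ^ 2) + 20) +
      (Suc m ^ Suc K * 100 + 100) + 200 * (m + 1) + 100"
  shows "l \<le> 2000 * (1 + m) ^ (n + 4)"
proof -
  define X where "X = Suc m ^ (n + 4)"
  have pow: "Suc m ^ j \<le> X" if "j \<le> n + 4" for j
    unfolding X_def using that by (intro power_increasing) auto
  have "n < 2 ^ n" by (rule less_exp)
  also have "(2 :: nat) ^ n \<le> Suc m ^ n" using assms(1) by (intro power_mono) auto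
  finally have "n + 1 \<le> X" using pow[of n] by simp
  moreover have "(m + 1) ^ 2 \<le> X" "m + 1 \<le> X" "1 \<le> X"
    using pow[of 2] pow[of 1] pow[of 0] by simp_all
  moreover have "Suc m ^ Suc K * (m + 1) ^ 2 \<le> X" "Suc m ^ Suc K \<le> X"
    using pow[of "Suc K + 2"] pow[of "Suc K"] assms(2) by (simp_all only: power_add) simp_all
  ultimately have "l \<le> 2000 * X" using assms(3) by simp
  then show ?thesis by (simp add: X_def)
qed

theorem best_response_program_correct:
  "\<exists>k s. exec best_response_program (initial_state I) k s \<and> k \<le> 2000 * (1 + m) ^ (n + 4) \<and>
    best_response I (output_strategy I s)"
proof -
  define s0 where "s0 = initial_state I"
  have in0: "input_ok s0" unfolding s0_def by (rule input_ok_initial_state)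
  have m0: "nmem s0 0 0 = m" using in0 by (simp add: input_ok_def)
  have zero: "nmem s0 a = (\<lambda>_. 0)" if "3 \<le> a" for a
    using initial_state_zero(1)[OF that] by (simp add: s0_def)
  have "wp best_response_program s0 0 (\<lambda>s k. k \<le> 2000 * (1 + m) ^ (n + 4) \<and>
    best_response I (output_strategy I s))"
  proof (cases "m = 0")
    case True
    have "opt 0 start = ([], [])" using True by (subst opt_unfold) simp
    then have "best_response I []" using True best_response_opt[of "[]" "[]" "[]"] by simp
    then show ?thesis
      using True m0 by (simp add: best_response_program_def wp_simps output_strategy_def)
  next
    case m: False
    have "wp (bases ;; weights ;; table ;; walk ;; append_flagged 0 ;; append_flagged 2) s0
      (0 + (1 + bcost (NLess (Const 0) vM)))
      (\<lambda>s k. k \<le> 2000 * (1 + m) ^ (n + 4) \<and> best_response I (output_strategy I s))"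
      unfolding wp_Seq
    proof (rule wp_bases[OF in0], goal_cases)
      case 1
      show ?case using zero[of vAcc] by simp
    next
      case (2 s1 l1)
      note l1 = 2(3)
      have in1: "input_ok s1" using 2(2) in0 by (rule input_ok_frame) simp
      \<comment> \<open>Arrays outside the frame keep their initial zeros, on which the later phases
        rely as default values.\<close>
      have z1: "nmem s1 a = (\<lambda>_. 0)" if "3 \<le> a" "a \<notin> {vI, aBase, vAcc}" for a
        using zero[OF that(1)] 2(2) that by (simp add: frame_def)
      show ?case
      proof (rule wp_weights[OF in1], goal_cases)
        case (3 s2 l2 as)
        note l2 = 3(4)
        have "input_ok s2" using 3(3) in1 by (rule input_ok_frame) simp
        moreover have "nmem s2 aBase = nmem s1 aBase" using 3(3) by (simp add: frame_def)
        ultimately have rdy: "ready as s2" using 2(1) 3(1,2) by (simp add: ready_def)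
        have z2: "nmem s2 a = (\<lambda>_. 0)"
          if "3 \<le> a" "a \<notin> {vI, vK, vTot, aWeight, aAgent, aBase, vAcc, vA, vQ}" for a
          using z1[of a] 3(3) that by (simp add: frame_def)
        have "rmem s2 1 = (\<lambda>_. 0)"
          using 2(2) 3(3) initial_state_zero(2) by (simp add: frame_def s0_def)
        then have emp: "empty_at c s2" for c
          by (simp add: empty_at_def z2)
        show ?case
        proof (rule wp_table[OF rdy emp], goal_cases)
          case 1
          show ?case using z2[of aMark] by simp
        next
          case (2 s3 l3)
          note l3 = 2(4)
          have z3: "nmem s3 aFlag = (\<lambda>_. 0)" using 2(3) z2[of aFlag] by simp
          show ?case
          proof (rule wp_walk[OF 2(1,2) z3], goal_cases)
            case (1 s4 l4)
            note fl4 = 1(3) and l4 = 1(4)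
            have m4: "nmem s4 0 0 = m" using 1(1) readyD(1)[OF 2(1)] by simp
            show ?case
            proof (rule wp_append_flagged[OF m4 1(2)], goal_cases)
              case (1 s5 l5)
              note l5 = 1(3)
              have s5: "nmem s5 0 0 = m" "nmem s5 aFlag = nmem s4 aFlag"
                using 1(1) m4 by (auto simp: frame_def)
              show ?case
              proof (rule wp_append_flagged[OF s5(1) 1(2)], goal_cases)
                case (1 s6 l6)
                define \<sigma> where "\<sigma> = fst (opt 0 start) @
                  filter (\<lambda>x. nmem s4 aFlag x = 0) [1..<Suc m] @
                  filter (\<lambda>x. nmem s4 aFlag x = 2) [1..<Suc m]"
                have br: "best_response I \<sigma>"
                  unfolding \<sigma>_def by (rule best_response_flags[OF fl4])
                then have "length \<sigma> = m"
                  by (auto simp: best_response_def permutations_of_set_def items_def dest: distinct_card)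
                moreover have "holds_list s6 \<sigma>"
                  using 1(2) by (simp add: \<sigma>_def s5(2) del: upt_Suc)
                ultimately have "output_strategy I s6 = \<sigma>"
                  by (intro nth_equalityI) (auto simp: output_strategy_def holds_list_def)
                moreover have "l6 \<le> 2000 * (1 + m) ^ (n + 4)"
                proof (rule time_bound)
                  show "0 < m" using m by simp
                  show "length as < n" by (rule readyD(13)[OF rdy])
                qed (use l1 l2 l3 l4 l5 1(3) in simp)
                ultimately show ?case using br by simp
              qed
            qed
          qed
        qed
      qed (use z1 in auto)
    qed
    then show ?thesis
      using m m0 by (simp add: best_response_program_def wp_Cond)
  qed
  then show ?thesis by (auto simp: wp_def s0_def)
qed

end

theorem theorem1:
  shows "(\<exists>(c :: com) (C :: nat).
            solves_best_response_in_time c {I. valid I}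
              (\<lambda>I. C * (1 + num_items I) ^ (num_agents I + 4))) \<and>
         (\<forall>n \<ge> 1. \<exists>(c :: com) (C :: nat) (d :: nat).
            solves_best_response_in_time c {I. valid I \<and> num_agents I = n}
              (\<lambda>I. C * input_size I ^ d))"
proof -
  have run: "\<exists>k s. exec best_response_program (initial_state I) k s \<and>
      k \<le> 2000 * (1 + num_items I) ^ (num_agents I + 4) \<and> best_response I (output_strategy I s)"
    if "valid I" for I
    by (rule sequential_allocation.best_response_program_correct) (unfold_locales, fact)
  \<comment> \<open>The input has at least \<open>1 + m\<close> cells, and for fixed
    \<open>n\<close> the exponent \<open>n + 4\<close> is a constant.\<close>
  have poly: "2000 * (1 + num_items I) ^ d \<le> 2000 * input_size I ^ d" for I d
    by (intro mult_le_mono2 power_mono) (auto simp: input_size_def)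
  have "solves_best_response_in_time best_response_program {I. valid I}
      (\<lambda>I. 2000 * (1 + num_items I) ^ (num_agents I + 4))"
    using run by (simp add: solves_best_response_in_time_def)
  moreover have "solves_best_response_in_time best_response_program {I. valid I \<and> num_agents I = n}
      (\<lambda>I. 2000 * input_size I ^ (n + 4))" for n
    unfolding solves_best_response_in_time_def
  proof
    fix I assume "I \<in> {I. valid I \<and> num_agents I = n}"
    with run[of I] poly[of I "n + 4"] show "\<exists>k s. exec best_response_program (initial_state I) k s \<and>
        k \<le> 2000 * input_size I ^ (n + 4) \<and> best_response I (output_strategy I s)"
      using order_trans by blast
  qed
  ultimately show ?thesis by blast
qed

end
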